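(* For every $n$ there exists a Hermitian operator $M$ with $0\le M\le I$ on $\mathbb C^d\otimes\mathbb C^d$ with $d=O(n)$ such that $h_{\mathrm{Sep}(d,d)}(M)\le 1-\tilde\Omega(1/n)$, but $\mathrm{DPS}_k(M)=1$ for all $k\le o(n)$. (Here $\tilde\Omega$ hides polylogarithmic factors in $n$.)
   Context: $h_{\mathrm{Sep}(d,d)}(M)=\max\operatorname{tr}(M\,\psi\psi^*\otimes\phi\phi^* )$ over unit vectors $\psi,\phi\in\mathbb C^d$. $\mathrm{DPS}_k(M)=\max\operatorname{tr}(M\rho)$ over $k$-extendable PPT states: bipartite states $\rho$ on $A\otimes B$ ($A\cong B\cong\mathbb C^d$) such that there is a state $\tilde\rho$ on $A_1\cdots A_kB_1\cdots B_k$ with $\rho=\tilde\rho^{A_1B_1}$, the support of $\tilde\rho^{A_1\dots A_k}$ (resp. $\tilde\rho^{B_1\dots B_k}$) contained in the symmetric subspace of $A^{\otimes k}$ (resp. $B^{\otimes k}$), and the partial transpose of $\tilde\rho$ with respect to every subset of subsystems positive semidefinite. *)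

theory Defs
  imports Complex_Main "HOL-Library.Landau_Symbols"
begin

text \<open>Operators on (C^d)^{\<otimes>m} are represented as functions
  nat list => nat list => complex, where the basis of (C^d)^{\<otimes>m}
  is indexed by lists of length m with entries < d.  Only the values on
  idx d m matter.  Vectors are functions nat list => complex.\<close>

type_synonym op = "nat list \<Rightarrow> nat list \<Rightarrow> complex"
type_synonym vec = "nat list \<Rightarrow> complex"

definition idx :: "nat \<Rightarrow> nat \<Rightarrow> nat list set" where
  "idx d m = {xs. length xs = m \<and> set xs \<subseteq> {..<d}}"

definition op_eq :: "nat \<Rightarrow> nat \<Rightarrow> op \<Rightarrow> op \<Rightarrow> bool" where
  "op_eq d m A B \<longleftrightarrow> (\<forall>x\<in>idx d m. \<forall>y\<in>idx d m. A x y = B x y)"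

definition hermitian :: "nat \<Rightarrow> nat \<Rightarrow> op \<Rightarrow> bool" where
  "hermitian d m A \<longleftrightarrow> (\<forall>x\<in>idx d m. \<forall>y\<in>idx d m. A x y = cnj (A y x))"

definition qform :: "nat \<Rightarrow> nat \<Rightarrow> op \<Rightarrow> vec \<Rightarrow> complex" where
  "qform d m A v = (\<Sum>x\<in>idx d m. \<Sum>y\<in>idx d m. cnj (v x) * A x y * v y)"

definition psd :: "nat \<Rightarrow> nat \<Rightarrow> op \<Rightarrow> bool" where
  "psd d m A \<longleftrightarrow> hermitian d m A \<and>
     (\<forall>v. Im (qform d m A v) = 0 \<and> Re (qform d m A v) \<ge> 0)"

definition id_op :: op where
  "id_op x y = (if x = y then 1 else 0)"

definition tr :: "nat \<Rightarrow> nat \<Rightarrow> op \<Rightarrow> complex" where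
  "tr d m A = (\<Sum>x\<in>idx d m. A x x)"

definition tr_prod :: "nat \<Rightarrow> nat \<Rightarrow> op \<Rightarrow> op \<Rightarrow> complex" where
  "tr_prod d m A B = (\<Sum>x\<in>idx d m. \<Sum>y\<in>idx d m. A x y * B y x)"

definition is_state :: "nat \<Rightarrow> nat \<Rightarrow> op \<Rightarrow> bool" where
  "is_state d m \<rho> \<longleftrightarrow> psd d m \<rho> \<and> tr d m \<rho> = 1"

text \<open>Reduced operator on the subsystems with positions in P (in increasing
  order), i.e. partial trace over the complementary positions of an n-party
  operator.\<close>
definition reduce :: "nat \<Rightarrow> nat \<Rightarrow> nat set \<Rightarrow> op \<Rightarrow> op" where
  "reduce d n P \<rho> i j = (\<Sum>x\<in>idx d n. \<Sum>y\<in>idx d n.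
     if nths x P = i \<and> nths y P = j \<and> (\<forall>p<n. p \<notin> P \<longrightarrow> x ! p = y ! p)
     then \<rho> x y else 0)"

definition ptrans :: "nat set \<Rightarrow> op \<Rightarrow> op" where
  "ptrans S \<rho> x y = \<rho> (map (\<lambda>p. if p \<in> S then y ! p else x ! p) [0..<length x])
                      (map (\<lambda>p. if p \<in> S then x ! p else y ! p) [0..<length y])"

definition sym_subspace :: "nat \<Rightarrow> nat \<Rightarrow> vec set" where
  "sym_subspace d k = {v. \<forall>\<pi> x. bij_betw \<pi> {..<k} {..<k} \<and> x \<in> idx d k \<longrightarrow>
       v (map (\<lambda>i. x ! \<pi> i) [0..<k]) = v x}"

definition apply_op :: "nat \<Rightarrow> nat \<Rightarrow> op \<Rightarrow> vec \<Rightarrow> vec" where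
  "apply_op d m A v = (\<lambda>x. \<Sum>y\<in>idx d m. A x y * v y)"

text \<open>Support (= range, for Hermitian operators) contained in a subspace V.\<close>
definition support_in :: "nat \<Rightarrow> nat \<Rightarrow> op \<Rightarrow> vec set \<Rightarrow> bool" where
  "support_in d m A V \<longleftrightarrow>
     (\<forall>v. \<exists>w\<in>V. \<forall>x\<in>idx d m. apply_op d m A v x = w x)"

text \<open>k-extendable PPT states on C^d \<otimes> C^d.  Subsystems of the extension are
  ordered A_1..A_k B_1..B_k (positions 0..k-1 and k..2k-1).\<close>
definition kext_ppt :: "nat \<Rightarrow> nat \<Rightarrow> op \<Rightarrow> bool" where
  "kext_ppt d k \<rho> \<longleftrightarrow> is_state d 2 \<rho> \<and>
     (\<exists>\<rho>t. is_state d (2*k) \<rho>t \<and>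
        op_eq d 2 (reduce d (2*k) {0, k} \<rho>t) \<rho> \<and>
        support_in d k (reduce d (2*k) {0..<k} \<rho>t) (sym_subspace d k) \<and>
        support_in d k (reduce d (2*k) {k..<2*k} \<rho>t) (sym_subspace d k) \<and>
        (\<forall>S. S \<subseteq> {..<2*k} \<longrightarrow> psd d (2*k) (ptrans S \<rho>t)))"

definition DPS :: "nat \<Rightarrow> nat \<Rightarrow> op \<Rightarrow> real" where
  "DPS d k M = Sup {Re (tr_prod d 2 M \<rho>) | \<rho>. kext_ppt d k \<rho>}"

definition unit_vec :: "nat \<Rightarrow> (nat \<Rightarrow> complex) \<Rightarrow> bool" where
  "unit_vec d \<psi> \<longleftrightarrow> (\<Sum>a<d. (cmod (\<psi> a))\<^sup>2) = 1"

definition prod_pure :: "(nat \<Rightarrow> complex) \<Rightarrow> (nat \<Rightarrow> complex) \<Rightarrow> op" where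
  "prod_pure \<psi> \<phi> x y =
     \<psi> (x!0) * cnj (\<psi> (y!0)) * \<phi> (x!1) * cnj (\<phi> (y!1))"

definition hSep :: "nat \<Rightarrow> op \<Rightarrow> real" where
  "hSep d M = Sup {Re (tr_prod d 2 M (prod_pure \<psi> \<phi>)) | \<psi> \<phi>.
                     unit_vec d \<psi> \<and> unit_vec d \<phi>}"

end

theory Submission
  imports Defs "HOL-Library.FuncSet"
begin

text \<open>
  A random system of \<open>16 N\<close> constraints \<open>x_i x_j x_k x_l = \<plusminus>1\<close> in \<open>N\<close> sign variables is far
  from satisfiable, yet every set of \<open>\<le> \<delta> N\<close> constraints expands. By expansion, deriving
  consequences with few constraints never leads to a contradiction, which gives Grigoriev's
  pseudo-expectation \<open>L\<close> of degree \<open>\<Omega>(N)\<close>. Its moment matrix, with entries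
  \<open>L(x^{\<otimes>4k}) / N^{2k}\<close>, is a state on \<open>2k\<close> systems that is invariant under all partial
  transposes and under all permutations, so its two-party marginal is a \<open>k\<close>-extendable PPT state.

  Being homogeneous, the constraints \<open>x_i x_j = \<plusminus> x_k x_l\<close>, \<open>x_i x_i = x_j x_j\<close> and
  \<open>x_i y_j = x_j y_i\<close> are linear conditions on \<open>x \<otimes> y\<close>. The operator \<open>M\<close> is the identity minus
  the normalised sum of their squares. The pseudo-state satisfies all of them exactly. A product
  state violating all of them by \<open>o(1/N)\<close> would have \<open>y \<propto> x\<close> and nearly all \<open>x_i\<close> close to
  \<open>\<plusminus>\<nu>\<close>, hence would satisfy almost all of the system.
\<close>

section \<open>Positive semidefinite operators\<close>

lemma finite_idx [simp]: "finite (idx d m)"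
  using finite_lists_length_eq[of "{..<d}" m] by (simp add: idx_def conj_commute)

lemma card_idx: "card (idx d m) = d ^ m"
  using card_lists_length_eq[of "{..<d}" m] by (simp add: idx_def conj_commute)

text \<open>Such an \<open>A\<close> is a sum of rank-one positive operators: its quadratic form at
  \<open>v\<close> is the sum of the squared moduli of the inner products of the \<open>u t\<close>
  with \<open>v\<close>.\<close>

lemma psd_if_sum_of_squares:
  assumes "finite T"
    and A: "\<And>x y. x \<in> idx d m \<Longrightarrow> y \<in> idx d m \<Longrightarrow> A x y = (\<Sum>t\<in>T. u t x * cnj (u t y))"
  shows "psd d m A"
proof -
  have "qform d m A v = of_real (\<Sum>t\<in>T. (cmod (\<Sum>y\<in>idx d m. cnj (u t y) * v y))\<^sup>2)" for v
  proof -
    have "qform d m A v = (\<Sum>x\<in>idx d m. \<Sum>y\<in>idx d m. \<Sum>t\<in>T. (cnj (v x) * u t x) * (cnj (u t y) * v y))"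
      unfolding qform_def
      by (intro sum.cong refl) (simp only: A sum_distrib_left sum_distrib_right mult.assoc)
    also have "\<dots> = (\<Sum>x\<in>idx d m. \<Sum>t\<in>T. \<Sum>y\<in>idx d m. (cnj (v x) * u t x) * (cnj (u t y) * v y))"
      by (intro sum.cong refl sum.swap)
    also have "\<dots> = (\<Sum>t\<in>T. \<Sum>x\<in>idx d m. \<Sum>y\<in>idx d m. (cnj (v x) * u t x) * (cnj (u t y) * v y))"
      by (rule sum.swap)
    also have "\<dots> = (\<Sum>t\<in>T. cnj (\<Sum>y\<in>idx d m. cnj (u t y) * v y) * (\<Sum>y\<in>idx d m. cnj (u t y) * v y))"
      unfolding cnj_sum sum_product complex_cnj_mult complex_cnj_cnj
      by (simp only: mult.commute[of "u _ _"])
    also have "\<dots> = of_real (\<Sum>t\<in>T. (cmod (\<Sum>y\<in>idx d m. cnj (u t y) * v y))\<^sup>2)"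
      unfolding of_real_sum by (intro sum.cong refl) (metis complex_norm_square mult.commute)
    finally show ?thesis .
  qed
  moreover have "hermitian d m A"
    unfolding hermitian_def by (simp add: A) (simp add: mult.commute)
  ultimately show ?thesis
    unfolding psd_def by (simp add: sum_nonneg)
qed

lemma psd_cong:
  assumes eq: "op_eq d m A B" and B: "psd d m B"
  shows "psd d m A"
proof -
  have "qform d m A = qform d m B"
    using eq unfolding qform_def op_eq_def by (intro ext sum.cong) auto
  moreover have "hermitian d m A"
    unfolding hermitian_def
  proof (intro ballI)
    fix x y assume xy: "x \<in> idx d m" "y \<in> idx d m"
    then have "A x y = B x y" "A y x = B y x" using eq unfolding op_eq_def by blast+
    moreover have "B x y = cnj (B y x)" using B xy unfolding psd_def hermitian_def by blast
    ultimately show "A x y = cnj (A y x)" by (simp only:)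
  qed
  ultimately show ?thesis using B unfolding psd_def by (simp only:) blast
qed

text \<open>Such a kernel is, up to signs, the indicator of an equivalence relation.\<close>
lemma psd_if_multiplicative_kernel:
  fixes K :: "nat list \<Rightarrow> nat list \<Rightarrow> real"
  assumes refl: "\<And>x. x \<in> idx d m \<Longrightarrow> K x x = 1"
    and sym: "\<And>x y. x \<in> idx d m \<Longrightarrow> y \<in> idx d m \<Longrightarrow> K x y = K y x"
    and mult: "\<And>x y z. x \<in> idx d m \<Longrightarrow> y \<in> idx d m \<Longrightarrow> z \<in> idx d m \<Longrightarrow>
      K x y \<noteq> 0 \<Longrightarrow> K y z \<noteq> 0 \<Longrightarrow> K x z = K x y * K y z"
    and a: "a \<ge> 0"
  shows "psd d m (\<lambda>x y. of_real (K x y * a))"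
proof -
  \<comment> \<open>\<open>K x y \<noteq> 0\<close> is an equivalence relation. The choice
    \<open>r x\<close> depends only on the class of \<open>x\<close>, so equivalent points get the
    same representative.\<close>
  define r where "r x = (SOME y. y \<in> idx d m \<and> K x y \<noteq> 0)" for x
  have r: "r x \<in> idx d m \<and> K x (r x) \<noteq> 0" if "x \<in> idx d m" for x
    unfolding r_def by (rule someI[of _ x]) (use that refl in auto)
  have r_eq: "r x = r y" if "x \<in> idx d m" "y \<in> idx d m" "K x y \<noteq> 0" for x y
  proof -
    have step: "K v z \<noteq> 0" if "v \<in> idx d m" "w \<in> idx d m" "z \<in> idx d m" "K v w \<noteq> 0" "K w z \<noteq> 0" for v w z
      using mult[OF that] that(4,5) by simp
    have "K y x \<noteq> 0" using sym[OF that(1,2)] that(3) by (simp only:) simp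
    then have "(z \<in> idx d m \<and> K x z \<noteq> 0) = (z \<in> idx d m \<and> K y z \<noteq> 0)" for z
      using that step by blast
    then show ?thesis unfolding r_def by simp
  qed
  define u where "u t x = (if r x = t then of_real (K x t * sqrt a) else 0 :: complex)" for t x
  show ?thesis
  proof (rule psd_if_sum_of_squares[where T = "r ` idx d m" and u = u])
    fix x y assume xy: "x \<in> idx d m" "y \<in> idx d m"
    have "(\<Sum>t\<in>r ` idx d m. u t x * cnj (u t y)) = (\<Sum>t\<in>{r x}. u t x * cnj (u t y))"
      using xy by (intro sum.mono_neutral_right) (auto simp: u_def)
    also have "\<dots> = of_real (K x y * a)"
    proof (cases "r x = r y")
      case True
      have sym': "K (r x) y = K y (r x)" using xy r[of x] by (intro sym) auto
      have "K x y = K x (r x) * K (r x) y"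
        by (rule mult) (use xy r[of x] r[of y] True sym' in auto)
      also note sym'
      finally have "K x y * a = (K x (r x) * sqrt a) * (K y (r x) * sqrt a)"
        using a by (simp add: mult_ac)
      then show ?thesis using True
        by (simp add: u_def del: of_real_mult) (simp only: of_real_mult)
    next
      case False
      then show ?thesis using r_eq[of x y] xy by (auto simp: u_def)
    qed
    finally show "of_real (K x y * a) = (\<Sum>t\<in>r ` idx d m. u t x * cnj (u t y))" by simp
  qed simp
qed

section \<open>Pseudo-expectations of expanding XOR systems\<close>

text \<open>Modulo \<open>x_i^2 = 1\<close>, the monomial with variable list \<open>z\<close> is
  determined by its variables of odd exponent, and products become symmetric differences.\<close>

definition par :: "nat list \<Rightarrow> nat set" where
  "par z = {i. odd (count_list z i)}"

lemma par_append: "par (x @ y) = sym_diff (par x) (par y)"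
  by (auto simp: par_def)

lemma par_subset: "par z \<subseteq> set z"
  by (auto simp: par_def) (metis count_list_0_iff even_zero)

lemma card_par_le: "card (par z) \<le> length z"
  by (meson List.finite_set card_length card_mono le_trans par_subset)

lemma sum_sym_diff:
  fixes g :: "nat \<Rightarrow> nat"
  assumes "finite I" "finite J"
  shows "(\<Sum>c\<in>sym_diff I J. g c) + 2 * (\<Sum>c\<in>I\<inter>J. g c) = (\<Sum>c\<in>I. g c) + (\<Sum>c\<in>J. g c)"
proof -
  have "(\<Sum>c\<in>sym_diff I J. g c) = (\<Sum>c\<in>I - J. g c) + (\<Sum>c\<in>J - I. g c)"
    using assms by (intro sum.union_disjoint) auto
  then show ?thesis
    using sum.Int_Diff[OF assms(1), of g J] sum.Int_Diff[OF assms(2), of g I]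
    by (simp add: Int_commute)
qed


text \<open>Constraint \<open>c\<close> reads: the product of the variables listed in
  \<open>f c\<close>, repetitions allowed, equals \<open>b c\<close>. The expansion factor 5/2
  exceeds 2, half the number of positions, and this forces variables of odd total
  multiplicity.\<close>

locale xor_expander =
  fixes N m s :: nat and f :: "nat \<Rightarrow> nat list" and b :: "nat \<Rightarrow> real"
  assumes f_idx: "\<And>c. c < m \<Longrightarrow> f c \<in> idx N 4"
    and b_sq: "\<And>c. c < m \<Longrightarrow> b c * b c = 1"
    and expansion: "\<And>I. I \<subseteq> {..<m} \<Longrightarrow> card I \<le> s \<Longrightarrow> 5 * card I \<le> 2 * card (\<Union>c\<in>I. set (f c))"
begin

text \<open>The exponent set left when the constraints in \<open>I\<close> are multiplied and
  squares cancel: they imply \<open>x^(bnd I) = (\<Prod>c\<in>I. b c)\<close>.\<close>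

definition bnd :: "nat set \<Rightarrow> nat set" where
  "bnd I = {i. odd (\<Sum>c\<in>I. count_list (f c) i)}"

lemma bnd_subset: "bnd I \<subseteq> (\<Union>c\<in>I. set (f c))"
proof
  fix i assume "i \<in> bnd I"
  then have "(\<Sum>c\<in>I. count_list (f c) i) \<noteq> 0" unfolding bnd_def using odd_pos by fastforce
  then obtain c where "c \<in> I" "count_list (f c) i \<noteq> 0" by (meson sum.not_neutral_contains_not_neutral)
  then show "i \<in> (\<Union>c\<in>I. set (f c))" by (auto simp: count_list_0_iff)
qed

text \<open>Double counting of the \<open>4 * card I\<close> positions: a variable seen but not in
  \<open>bnd I\<close> occurs at least twice, so
  \<open>2 * card G \<le> 4 * card I + card (bnd I)\<close>, while expansion gives
  \<open>5 * card I \<le> 2 * card G\<close>.\<close>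

lemma card_le_card_bnd:
  assumes I: "I \<subseteq> {..<m}" "card I \<le> s"
  shows "card I \<le> card (bnd I)"
proof -
  define G where "G = (\<Union>c\<in>I. set (f c))"
  define cnt where "cnt i = (\<Sum>c\<in>I. count_list (f c) i)" for i
  have fin: "finite I" using I finite_subset by blast
  then have finG: "finite G" unfolding G_def by auto
  have "2 * card G = (\<Sum>i\<in>G. 2)" by simp
  also have "\<dots> \<le> (\<Sum>i\<in>G. cnt i + of_bool (i \<in> bnd I))"
  proof (rule sum_mono)
    fix i assume "i \<in> G"
    then obtain c where "c \<in> I" "i \<in> set (f c)" unfolding G_def by auto
    then have "cnt i \<noteq> 0" unfolding cnt_def using fin by (auto simp: count_list_0_iff)
    then show "2 \<le> cnt i + of_bool (i \<in> bnd I)"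
      by (cases "cnt i = 1") (auto simp: bnd_def cnt_def)
  qed
  also have "\<dots> = (\<Sum>c\<in>I. \<Sum>i\<in>G. count_list (f c) i) + card (bnd I)"
  proof -
    have "(\<Sum>i\<in>G. of_bool (i \<in> bnd I)) = card (G \<inter> bnd I)"
      using finG by (simp add: of_bool_def sum.If_cases)
    moreover have "G \<inter> bnd I = bnd I" using bnd_subset unfolding G_def by blast
    ultimately show ?thesis
      unfolding sum.distrib cnt_def by (simp add: sum.swap[of _ I G])
  qed
  also have "(\<Sum>c\<in>I. \<Sum>i\<in>G. count_list (f c) i) = (\<Sum>c\<in>I. 4)"
  proof (rule sum.cong[OF refl])
    fix c assume c: "c \<in> I"
    then have "(\<Sum>i\<in>G. count_list (f c) i) = length (f c)"
      using finG by (intro sum_count_set) (auto simp: G_def)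
    also have "\<dots> = 4" using f_idx[of c] c I by (auto simp: idx_def)
    finally show "(\<Sum>i\<in>G. count_list (f c) i) = 4" .
  qed
  finally have "2 * card G \<le> 4 * card I + card (bnd I)" by simp
  with expansion[OF I] show ?thesis unfolding G_def by simp
qed

lemma bnd_sym_diff:
  assumes "finite I" "finite J"
  shows "bnd (sym_diff I J) = sym_diff (bnd I) (bnd J)"
proof -
  have "odd (\<Sum>c\<in>sym_diff I J. count_list (f c) i) \<longleftrightarrow>
    odd ((\<Sum>c\<in>I. count_list (f c) i) + (\<Sum>c\<in>J. count_list (f c) i))" for i
    unfolding sum_sym_diff[OF assms, symmetric] by simp
  then show ?thesis unfolding bnd_def by auto
qed

text \<open>Half the expansion size, so that the symmetric difference of two such sets still
  expands.\<close>

definition small :: "nat set \<Rightarrow> bool" where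
  "small I \<longleftrightarrow> I \<subseteq> {..<m} \<and> 2 * card I \<le> s"

lemma small_finite: "small I \<Longrightarrow> finite I"
  unfolding small_def using finite_subset by blast

lemma small_sym_diff:
  assumes I: "small I" "small J"
  shows "sym_diff I J \<subseteq> {..<m}" "card (sym_diff I J) \<le> s"
proof -
  have "card (sym_diff I J) \<le> card (I \<union> J)"
    using small_finite I by (intro card_mono) auto
  also have "\<dots> \<le> card I + card J" by (rule card_Un_le)
  finally show "card (sym_diff I J) \<le> s" using I unfolding small_def by linarith
qed (use I in \<open>auto simp: small_def\<close>)

text \<open>A monomial has at most one small derivation: two of them differ by a set with empty
  boundary, which expansion forces to be empty. Hence no contradictory values arise.\<close>

lemma bnd_inj:
  assumes I: "small I" "small J" and "bnd I = bnd J"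
  shows "I = J"
proof -
  have "bnd (sym_diff I J) = {}"
    using bnd_sym_diff[OF small_finite small_finite, OF I] assms by simp
  then have "card (sym_diff I J) = 0"
    using card_le_card_bnd[OF small_sym_diff[OF I]] by simp
  then have "sym_diff I J = {}" using small_finite I by (simp add: card_eq_0_iff)
  then show ?thesis by auto
qed

text \<open>The pseudo-expectation of the monomial with exponent set \<open>S\<close>.\<close>
definition L :: "nat set \<Rightarrow> real" where
  "L S = (if \<exists>I. small I \<and> bnd I = S then \<Prod>c\<in>(THE I. small I \<and> bnd I = S). b c else 0)"

lemma L_bnd:
  assumes "small I"
  shows "L (bnd I) = (\<Prod>c\<in>I. b c)"
proof -
  have "(THE J. small J \<and> bnd J = bnd I) = I"
    by (rule the_equality) (use assms bnd_inj in auto)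
  then show ?thesis unfolding L_def using assms by auto
qed

lemma L_nonzeroE:
  assumes "L S \<noteq> 0"
  obtains I where "small I" "bnd I = S"
  using assms that unfolding L_def by (auto split: if_splits)

lemma prod_b_sym_diff:
  assumes "small I" "small J"
  shows "(\<Prod>c\<in>sym_diff I J. b c) = (\<Prod>c\<in>I. b c) * (\<Prod>c\<in>J. b c)"
proof -
  note fin = small_finite[OF assms(1)] small_finite[OF assms(2)]
  have "(\<Prod>c\<in>sym_diff I J. b c) = (\<Prod>c\<in>I - J. b c) * (\<Prod>c\<in>J - I. b c)"
    using fin by (intro prod.union_disjoint) auto
  moreover have "(\<Prod>c\<in>I\<inter>J. b c) * (\<Prod>c\<in>I\<inter>J. b c) = 1"
    unfolding prod.distrib[symmetric] using assms b_sq by (intro prod.neutral) (auto simp: small_def)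
  ultimately show ?thesis
    using prod.Int_Diff[OF fin(1), of b J] prod.Int_Diff[OF fin(2), of b I]
    by (simp add: Int_commute mult_ac)
qed

text \<open>The combined derivation has at most \<open>s\<close> constraints, so it is no larger
  than its boundary \<open>sym_diff S T\<close>, which has at most \<open>s/2\<close> elements. It
  is therefore small again.\<close>

lemma L_mult:
  assumes "L S \<noteq> 0" "L T \<noteq> 0" "2 * card (sym_diff S T) \<le> s"
  shows "L (sym_diff S T) = L S * L T"
proof -
  obtain I J where I: "small I" "bnd I = S" and J: "small J" "bnd J = T"
    using assms L_nonzeroE by metis
  note IJ = small_sym_diff[OF I(1) J(1)]
  have bnd: "bnd (sym_diff I J) = sym_diff S T"
    using bnd_sym_diff small_finite I J by simp
  have "small (sym_diff I J)"
    using card_le_card_bnd[OF IJ] IJ assms(3) unfolding bnd small_def by auto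
  from L_bnd[OF this] show ?thesis
    unfolding bnd prod_b_sym_diff[OF I(1) J(1)] using L_bnd[OF I(1)] L_bnd[OF J(1)] I J by simp
qed

lemma L_empty: "L {} = 1"
  using L_bnd[of "{}"] by (simp add: small_def bnd_def)

lemma L_constraint: "c < m \<Longrightarrow> 2 \<le> s \<Longrightarrow> L (par (f c)) = b c"
  using L_bnd[of "{c}"] by (simp add: small_def bnd_def par_def)

text \<open>The moment matrix of \<open>L\<close> on \<open>n\<close> systems. Before scaling the
  diagonal entries are \<open>L {} = 1\<close>, so dividing by \<open>N^n\<close> makes the trace
  one.\<close>

definition rho :: "nat \<Rightarrow> op" where
  "rho n x y = of_real (L (par (x @ y)) * (1 / real N ^ n))"

lemma rho_state:
  assumes "4 * n \<le> s" "N > 0"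
  shows "is_state N n (rho n)"
proof -
  have "psd N n (\<lambda>x y. of_real (L (par (x @ y)) * (1 / real N ^ n)))"
  proof (rule psd_if_multiplicative_kernel)
    fix x y z assume *: "x \<in> idx N n" "y \<in> idx N n" "z \<in> idx N n"
      "L (par (x @ y)) \<noteq> 0" "L (par (y @ z)) \<noteq> 0"
    have eq: "par (x @ z) = sym_diff (par (x @ y)) (par (y @ z))"
      unfolding par_append by auto
    \<comment> \<open>The moment has degree at most \<open>2 * n\<close>, so
      \<open>4 * n \<le> s\<close> gives the degree condition of \<open>L_mult\<close>.\<close>
    have "2 * card (par (x @ z)) \<le> s"
      using card_par_le[of "x @ z"] * assms by (simp add: idx_def)
    then show "L (par (x @ z)) = L (par (x @ y)) * L (par (y @ z))"
      using L_mult * unfolding eq by blast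
  qed (auto simp: par_append L_empty Un_commute)
  moreover have "tr N n (rho n) = 1"
    using assms by (simp add: tr_def rho_def par_append L_empty card_idx)
  ultimately show ?thesis unfolding is_state_def rho_def[abs_def] by simp
qed

end

section \<open>Parity sets under partial transposes, permutations and partial traces\<close>

lemma count_list_map_upt: "count_list (map g [0..<n]) e = (\<Sum>p<n. of_bool (g p = e))"
  by (induction n) auto

lemma count_list_nth:
  assumes "length x = n"
  shows "count_list x e = (\<Sum>p<n. of_bool (x ! p = e))"
  using count_list_map_upt[of "(!) x" n e] assms map_nth[of x] by simp

text \<open>A partial transpose only exchanges entries between the row and the column index, so
  their joint multiset is unchanged.\<close>

lemma par_ptrans:
  assumes "length x = n" "length y = n"
  shows "par (map (\<lambda>p. if p \<in> S then y ! p else x ! p) [0..<n] @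
              map (\<lambda>p. if p \<in> S then x ! p else y ! p) [0..<n]) = par (x @ y)"
proof -
  have "count_list (map (\<lambda>p. if p \<in> S then y ! p else x ! p) [0..<n]) e +
    count_list (map (\<lambda>p. if p \<in> S then x ! p else y ! p) [0..<n]) e =
    count_list x e + count_list y e" for e
    unfolding count_list_map_upt count_list_nth[OF assms(1)] count_list_nth[OF assms(2)]
      sum.distrib[symmetric]
    by (intro sum.cong) auto
  then show ?thesis unfolding par_def count_list_append by simp
qed

lemma par_permute:
  assumes "length x = n" "bij_betw \<pi> {..<n} {..<n}"
  shows "par (map (\<lambda>i. x ! \<pi> i) [0..<n]) = par x"
  unfolding par_def count_list_map_upt count_list_nth[OF assms(1)]
  using sum.reindex_bij_betw[OF assms(2), of "\<lambda>p. of_bool (x ! p = _) :: nat"] by simp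

text \<open>A traced-out position carries the same symbol in row and column and contributes an even
  count, so moments survive partial traces.\<close>

lemma par_nths:
  assumes "length x = length y" "\<And>p. p < length x \<Longrightarrow> p \<notin> P \<Longrightarrow> x ! p = y ! p"
  shows "par (x @ y) = par (nths x P @ nths y P)"
proof -
  have "even (count_list x e + count_list y e + count_list (nths x P) e + count_list (nths y P) e)" for e
    using assms
  proof (induction x y arbitrary: P rule: list_induct2)
    case (Cons a x b y)
    have "x ! p = y ! p" if "p < length x" "p \<notin> {j. Suc j \<in> P}" for p
      using Cons.prems[of "Suc p"] that by auto
    then have "even (count_list x e + count_list y e + count_list (nths x {j. Suc j \<in> P}) e
        + count_list (nths y {j. Suc j \<in> P}) e)"
      by (rule Cons.IH)
    moreover have "0 \<notin> P \<Longrightarrow> a = b" using Cons.prems[of 0] by auto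
    ultimately show ?case by (auto simp: nths_Cons)
  qed auto
  then show ?thesis unfolding par_def count_list_append by auto
qed

text \<open>The index pairs summed for the entry \<open>(i, j)\<close> of a partial trace. The
  moment matrix is constant on each fibre, so only its size matters.\<close>

definition fibre :: "nat \<Rightarrow> nat \<Rightarrow> nat set \<Rightarrow> nat list \<Rightarrow> nat list \<Rightarrow> (nat list \<times> nat list) set" where
  "fibre d n P i j = {(x, y) \<in> idx d n \<times> idx d n.
     nths x P = i \<and> nths y P = j \<and> (\<forall>p<n. p \<notin> P \<longrightarrow> x ! p = y ! p)}"

lemma reduce_fibre: "reduce d n P \<rho> i j = (\<Sum>(x, y)\<in>fibre d n P i j. \<rho> x y)"
proof -
  have "(\<Sum>(x, y)\<in>fibre d n P i j. \<rho> x y) = (\<Sum>(x, y)\<in>idx d n \<times> idx d n.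
     if nths x P = i \<and> nths y P = j \<and> (\<forall>p<n. p \<notin> P \<longrightarrow> x ! p = y ! p) then \<rho> x y else 0)"
    unfolding fibre_def by (intro sum.mono_neutral_cong_left) (auto simp: split_def)
  then show ?thesis unfolding reduce_def by (simp add: sum.cartesian_product)
qed

lemma idx_Suc: "x \<in> idx d (Suc n) \<longleftrightarrow> (\<exists>a z. x = a # z \<and> a < d \<and> z \<in> idx d n)"
  by (cases x) (auto simp: idx_def)

text \<open>Each position outside \<open>P\<close> is free and carries one common symbol. The
  induction removes the first position and shifts \<open>P\<close> down by one.\<close>

lemma card_fibre:
  assumes "i \<in> idx d (card (P \<inter> {..<n}))" "j \<in> idx d (card (P \<inter> {..<n}))"
  shows "card (fibre d n P i j) = d ^ (n - card (P \<inter> {..<n}))"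
  using assms
proof (induction n arbitrary: P i j)
  case 0
  then have "fibre d 0 P i j = {([], [])}" by (auto simp: fibre_def idx_def)
  then show ?case by simp
next
  case (Suc n)
  define P' where "P' = {j. Suc j \<in> P}"
  have split: "P \<inter> {..<Suc n} = (if 0 \<in> P then {0} else {}) \<union> Suc ` (P' \<inter> {..<n})"
  proof (rule set_eqI)
    fix p show "p \<in> P \<inter> {..<Suc n} \<longleftrightarrow> p \<in> (if 0 \<in> P then {0} else {}) \<union> Suc ` (P' \<inter> {..<n})"
      by (cases p) (auto simp: P'_def)
  qed
  have cardS: "card (Suc ` (P' \<inter> {..<n})) = card (P' \<inter> {..<n})"
    by (simp add: card_image)
  show ?case
  proof (cases "0 \<in> P")
    case True
    have c: "card (P \<inter> {..<Suc n}) = Suc (card (P' \<inter> {..<n}))"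
      using True unfolding split by (simp add: cardS)
    obtain a i' b j' where ij: "i = a # i'" "j = b # j'" "a < d" "b < d"
        "i' \<in> idx d (card (P' \<inter> {..<n}))" "j' \<in> idx d (card (P' \<inter> {..<n}))"
      using Suc.prems unfolding c idx_Suc by blast
    have "fibre d (Suc n) P i j = (\<lambda>(x, y). (a # x, b # y)) ` fibre d n P' i' j'"
      using True ij(1-4)
      by (auto simp: fibre_def idx_Suc nths_Cons P'_def image_iff All_less_Suc2)
    moreover have "inj_on (\<lambda>(x, y). (a # x, b # y)) (fibre d n P' i' j')"
      by (auto simp: inj_on_def)
    ultimately show ?thesis using Suc.IH[OF ij(5,6)] unfolding c by (simp add: card_image)
  next
    case False
    have c: "card (P \<inter> {..<Suc n}) = card (P' \<inter> {..<n})"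
      using False unfolding split by (simp add: cardS)
    have le: "card (P' \<inter> {..<n}) \<le> n"
      using card_mono[of "{..<n}" "P' \<inter> {..<n}"] by simp
    have "fibre d (Suc n) P i j = (\<lambda>(a, x, y). (a # x, a # y)) ` ({..<d} \<times> fibre d n P' i j)"
      using False
      by (auto simp: fibre_def idx_Suc nths_Cons P'_def image_iff All_less_Suc2)
    moreover have "inj_on (\<lambda>(a, x, y). (a # x, a # y)) ({..<d} \<times> fibre d n P' i j)"
      by (auto simp: inj_on_def)
    ultimately show ?thesis using Suc.IH[of i P' j] Suc.prems le unfolding c
      by (simp add: card_image card_cartesian_product Suc_diff_le)
  qed
qed

section \<open>The moment matrix as a PPT extension\<close>

context xor_expander
begin

text \<open>Each fibre consists of \<open>N^(n - card P)\<close> equal moments, which turns the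
  normalisation \<open>1/N^n\<close> into \<open>1/N^(card P)\<close>.\<close>

lemma reduce_rho:
  assumes P: "P \<subseteq> {..<n}" and N: "N > 0"
  shows "op_eq N (card P) (reduce N n P (rho n)) (rho (card P))"
  unfolding op_eq_def
proof (intro ballI)
  fix i j assume ij: "i \<in> idx N (card P)" "j \<in> idx N (card P)"
  have PP: "P \<inter> {..<n} = P" using P by auto
  have le: "card P \<le> n" using card_mono[OF _ P] by simp
  have "reduce N n P (rho n) i j = (\<Sum>(x, y)\<in>fibre N n P i j. of_real (L (par (i @ j)) * (1 / real N ^ n)))"
    unfolding reduce_fibre
  proof (intro sum.cong refl, clarify)
    fix x y assume "(x, y) \<in> fibre N n P i j"
    then have "par (x @ y) = par (i @ j)"
      using par_nths[of x y P] by (auto simp: fibre_def idx_def)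
    then show "rho n x y = of_real (L (par (i @ j)) * (1 / real N ^ n))" by (simp add: rho_def)
  qed
  also have "\<dots> = of_nat (card (fibre N n P i j)) * of_real (L (par (i @ j)) * (1 / real N ^ n))"
    by simp
  also have "card (fibre N n P i j) = N ^ (n - card P)"
    using card_fibre[of i N P n j] ij unfolding PP by simp
  also have "of_nat (N ^ (n - card P)) * of_real (L (par (i @ j)) * (1 / real N ^ n)) = rho (card P) i j"
  proof -
    have "real (N ^ (n - card P)) * (1 / real N ^ n) = 1 / real N ^ card P"
      using N le by (simp add: field_simps flip: power_add)
    then have "real (N ^ (n - card P)) * (L (par (i @ j)) * (1 / real N ^ n)) =
        L (par (i @ j)) * (1 / real N ^ card P)" by (metis mult.left_commute)
    then show ?thesis unfolding rho_def by (metis of_real_mult of_real_of_nat_eq)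
  qed
  finally show "reduce N n P (rho n) i j = rho (card P) i j" .
qed

text \<open>Permuting the row index leaves its parity set fixed, so every vector in the range is
  symmetric.\<close>

lemma support_rho:
  assumes "op_eq N k A (rho k)"
  shows "support_in N k A (sym_subspace N k)"
  unfolding support_in_def
proof
  fix v
  have "apply_op N k (rho k) v \<in> sym_subspace N k"
    unfolding sym_subspace_def apply_op_def
    by (auto simp: rho_def par_append par_permute idx_def)
  moreover have "\<forall>x\<in>idx N k. apply_op N k A v x = apply_op N k (rho k) v x"
    using assms by (simp add: op_eq_def apply_op_def)
  ultimately show "\<exists>w\<in>sym_subspace N k. \<forall>x\<in>idx N k. apply_op N k A v x = w x" by blast
qed

text \<open>The extension is \<open>rho (2 * k)\<close>, and \<open>8 * k \<le> s\<close> is the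
  degree condition of \<open>rho_state\<close> for it. Partial transposes leave it unchanged, so its
  own positivity covers all \<open>S\<close>.\<close>

lemma kext_ppt_rho:
  assumes k: "1 \<le> k" "8 * k \<le> s" and N: "N > 0"
  shows "kext_ppt N k (rho 2)"
proof -
  have state: "is_state N (2 * k) (rho (2 * k))" using assms by (intro rho_state) auto
  have card: "card {0, k} = 2" "card {0..<k} = k" "card {k..<2 * k} = k" using k by auto
  have sub: "{0, k} \<subseteq> {..<2 * k}" "{0..<k} \<subseteq> {..<2 * k}" "{k..<2 * k} \<subseteq> {..<2 * k}"
    using k by auto
  have "op_eq N 2 (reduce N (2 * k) {0, k} (rho (2 * k))) (rho 2)"
    "op_eq N k (reduce N (2 * k) {0..<k} (rho (2 * k))) (rho k)"
    "op_eq N k (reduce N (2 * k) {k..<2 * k} (rho (2 * k))) (rho k)"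
    using sub[THEN reduce_rho, OF N] unfolding card by blast+
  moreover have "psd N (2 * k) (ptrans S (rho (2 * k)))" for S
  proof (rule psd_cong)
    show "op_eq N (2 * k) (ptrans S (rho (2 * k))) (rho (2 * k))"
      by (auto simp: op_eq_def ptrans_def rho_def idx_def par_ptrans)
    show "psd N (2 * k) (rho (2 * k))" using state by (simp add: is_state_def)
  qed
  ultimately show ?thesis
    unfolding kext_ppt_def using state support_rho rho_state[of 2] k N by auto
qed

end

section \<open>Signed Laplacians\<close>

text \<open>The real vector \<open>e_p - \<beta> e_q\<close>. The coefficients add when
  \<open>p = q\<close>, so loops need no separate case.\<close>

definition edge_vec :: "nat list \<Rightarrow> nat list \<Rightarrow> real \<Rightarrow> vec" where
  "edge_vec p q \<beta> x = of_real (of_bool (x = p) - \<beta> * of_bool (x = q))"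

lemma sum_edge_vec:
  assumes "p \<in> idx d n" "q \<in> idx d n"
  shows "(\<Sum>x\<in>idx d n. edge_vec p q \<beta> x * g x) = g p - of_real \<beta> * g q"
proof -
  have "(\<Sum>x\<in>idx d n. edge_vec p q \<beta> x * g x) =
    (\<Sum>x\<in>idx d n. (if x = p then g x else 0) - (if x = q then of_real \<beta> * g x else 0))"
    by (intro sum.cong) (auto simp: edge_vec_def algebra_simps)
  then show ?thesis using assms by (simp add: sum_subtractf)
qed

lemma cnj_edge_vec [simp]: "cnj (edge_vec p q \<beta> x) = edge_vec p q \<beta> x"
  by (simp add: edge_vec_def)

lemma qform_edge_vec:
  assumes "p \<in> idx d n" "q \<in> idx d n"
  shows "qform d n A (edge_vec p q \<beta>) =
    A p p - of_real \<beta> * A p q - of_real \<beta> * A q p + of_real (\<beta>\<^sup>2) * A q q"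
proof -
  have "qform d n A (edge_vec p q \<beta>) =
    (\<Sum>x\<in>idx d n. edge_vec p q \<beta> x * (\<Sum>y\<in>idx d n. edge_vec p q \<beta> y * A x y))"
    unfolding qform_def by (simp add: sum_distrib_left mult_ac)
  then show ?thesis unfolding sum_edge_vec[OF assms]
    by (simp add: algebra_simps power2_eq_square)
qed

lemma qform_eq_tr_prod: "qform d n A v = tr_prod d n A (\<lambda>x y. v x * cnj (v y))"
  by (simp add: qform_def tr_prod_def mult_ac)

lemma tr_prod_id: "tr_prod d n id_op A = tr d n A"
proof -
  have "(\<Sum>y\<in>idx d n. id_op x y * A y x) = A x x" if "x \<in> idx d n" for x
  proof -
    have "(\<Sum>y\<in>idx d n. id_op x y * A y x) = (\<Sum>y\<in>idx d n. if x = y then A y x else 0)"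
      by (intro sum.cong) (auto simp: id_op_def)
    then show ?thesis using that by simp
  qed
  then show ?thesis unfolding tr_prod_def tr_def by simp
qed


text \<open>A weighted signed graph Laplacian whose vertices are the basis vectors.\<close>
locale signed_graph =
  fixes d n :: nat and R :: "'r set" and w \<beta> :: "'r \<Rightarrow> real" and p q :: "'r \<Rightarrow> nat list" and D :: real
  assumes fin: "finite R"
    and w_nonneg: "\<And>r. r \<in> R \<Longrightarrow> w r \<ge> 0"
    and p_idx: "\<And>r. r \<in> R \<Longrightarrow> p r \<in> idx d n"
    and q_idx: "\<And>r. r \<in> R \<Longrightarrow> q r \<in> idx d n"
    and D_pos: "D > 0"
begin

definition lap :: op where
  "lap x y = (\<Sum>r\<in>R. of_real (w r) * edge_vec (p r) (q r) (\<beta> r) x * edge_vec (p r) (q r) (\<beta> r) y)"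

text \<open>The Dirichlet energy: it vanishes exactly when \<open>v\<close> satisfies the linear
  condition of every edge of positive weight.\<close>

definition energy :: "vec \<Rightarrow> real" where
  "energy v = (\<Sum>r\<in>R. w r * (cmod (v (p r) - of_real (\<beta> r) * v (q r)))\<^sup>2)"

text \<open>The measurement operator. It is positive once \<open>D\<close> bounds the largest
  eigenvalue of \<open>lap\<close>.\<close>

definition Mop :: op where
  "Mop x y = id_op x y - lap x y / of_real D"

lemma tr_prod_lap:
  "tr_prod d n lap A = (\<Sum>r\<in>R. of_real (w r) * qform d n A (edge_vec (p r) (q r) (\<beta> r)))"
proof -
  define e where "e r = edge_vec (p r) (q r) (\<beta> r)" for r
  have "tr_prod d n lap A = (\<Sum>x\<in>idx d n. \<Sum>y\<in>idx d n. \<Sum>r\<in>R. of_real (w r) * (e r y * A y x * e r x))"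
    unfolding tr_prod_def lap_def e_def sum_distrib_right by (simp add: mult_ac)
  also have "\<dots> = (\<Sum>y\<in>idx d n. \<Sum>x\<in>idx d n. \<Sum>r\<in>R. of_real (w r) * (e r y * A y x * e r x))"
    by (rule sum.swap)
  also have "\<dots> = (\<Sum>y\<in>idx d n. \<Sum>r\<in>R. \<Sum>x\<in>idx d n. of_real (w r) * (e r y * A y x * e r x))"
    by (intro sum.cong refl sum.swap)
  also have "\<dots> = (\<Sum>r\<in>R. \<Sum>y\<in>idx d n. \<Sum>x\<in>idx d n. of_real (w r) * (e r y * A y x * e r x))"
    by (rule sum.swap)
  finally show ?thesis unfolding qform_def sum_distrib_left e_def by simp
qed

lemma qform_lap: "qform d n lap v = of_real (energy v)"
proof -
  have "v a * cnj (v a) - of_real c * (v a * cnj (v b)) - of_real c * (v b * cnj (v a)) +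
      of_real (c\<^sup>2) * (v b * cnj (v b)) = of_real ((cmod (v a - of_real c * v b))\<^sup>2)" for a b c
    unfolding complex_norm_square by (simp add: algebra_simps power2_eq_square)
  then show ?thesis
    unfolding qform_eq_tr_prod[of d n lap v] tr_prod_lap energy_def of_real_sum of_real_mult
    by (intro sum.cong refl) (simp add: qform_edge_vec p_idx q_idx del: of_real_power)
qed

lemma energy_nonneg: "energy v \<ge> 0"
  unfolding energy_def by (intro sum_nonneg mult_nonneg_nonneg w_nonneg) auto

lemma tr_prod_Mop: "tr_prod d n Mop A = tr d n A - tr_prod d n lap A / of_real D"
  unfolding tr_prod_id[symmetric]
  unfolding tr_prod_def Mop_def by (simp add: left_diff_distrib sum_subtractf sum_divide_distrib)

lemma qform_Mop:
  "qform d n Mop v = of_real ((\<Sum>x\<in>idx d n. (cmod (v x))\<^sup>2) - energy v / D)"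
proof -
  have "tr d n (\<lambda>x y. v x * cnj (v y)) = of_real (\<Sum>x\<in>idx d n. (cmod (v x))\<^sup>2)"
    unfolding tr_def of_real_sum by (simp add: complex_norm_square del: of_real_power)
  then show ?thesis
    unfolding qform_eq_tr_prod tr_prod_Mop
    unfolding qform_eq_tr_prod[symmetric] qform_lap by simp
qed

lemma qform_id_minus_Mop: "qform d n (\<lambda>x y. id_op x y - Mop x y) v = of_real (energy v / D)"
proof -
  have "qform d n (\<lambda>x y. id_op x y - Mop x y) v = qform d n lap v / of_real D"
    unfolding qform_def Mop_def by (simp add: sum_divide_distrib)
  then show ?thesis by (simp add: qform_lap)
qed

lemma hermitian_Mop: "hermitian d n Mop"
  unfolding hermitian_def Mop_def lap_def by (auto simp: id_op_def mult_ac)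

lemma psd_id_minus_Mop: "psd d n (\<lambda>x y. id_op x y - Mop x y)"
  unfolding psd_def qform_id_minus_Mop
  using energy_nonneg D_pos by (auto simp: hermitian_def Mop_def lap_def mult_ac)

lemma psd_Mop:
  assumes "\<And>v. energy v \<le> D * (\<Sum>x\<in>idx d n. (cmod (v x))\<^sup>2)"
  shows "psd d n Mop"
  unfolding psd_def qform_Mop
  using assms hermitian_Mop D_pos by (auto simp: pos_divide_le_eq mult.commute)

end

section \<open>Two-party operators, product states and the DPS value\<close>

lemma idx_two: "idx d 2 = (\<lambda>(i, j). [i, j]) ` ({..<d} \<times> {..<d})"
proof -
  have "x \<in> idx d 2 \<longleftrightarrow> x \<in> (\<lambda>(i, j). [i, j]) ` ({..<d} \<times> {..<d})" for x
    by (auto simp: idx_def numeral_2_eq_2 length_Suc_conv image_iff)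
  then show ?thesis by blast
qed

lemma sum_idx_two: "(\<Sum>x\<in>idx d 2. g x) = (\<Sum>i<d. \<Sum>j<d. g [i, j])"
proof -
  have "(\<Sum>x\<in>idx d 2. g x) = (\<Sum>z\<in>{..<d} \<times> {..<d}. g (case z of (i, j) \<Rightarrow> [i, j]))"
    unfolding idx_two by (intro sum.reindex_cong[OF _ refl refl]) (auto simp: inj_on_def)
  then show ?thesis by (simp add: sum.cartesian_product split_def)
qed

definition prod_vec :: "(nat \<Rightarrow> complex) \<Rightarrow> (nat \<Rightarrow> complex) \<Rightarrow> vec" where
  "prod_vec \<psi> \<phi> x = \<psi> (x ! 0) * \<phi> (x ! 1)"

lemma norm_prod_vec:
  "(\<Sum>x\<in>idx d 2. (cmod (prod_vec \<psi> \<phi> x))\<^sup>2) = (\<Sum>i<d. (cmod (\<psi> i))\<^sup>2) * (\<Sum>i<d. (cmod (\<phi> i))\<^sup>2)"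
  by (simp add: sum_idx_two prod_vec_def norm_mult power_mult_distrib sum_product)

lemma Re_qform_psd: "psd d n A \<Longrightarrow> Re (qform d n A v) \<ge> 0"
  by (simp add: psd_def)

locale bipartite_signed_graph = signed_graph d 2 R w \<beta> p q D
  for d :: nat and R :: "'r set" and w \<beta> :: "'r \<Rightarrow> real" and p q :: "'r \<Rightarrow> nat list" and D :: real
begin

text \<open>A pure product state is the projector on the unit vector
  \<open>prod_vec \<psi> \<phi>\<close>, so its value is one minus its energy over
  \<open>D\<close>.\<close>

lemma hSep_le:
  assumes d: "d \<ge> 1"
    and E: "\<And>\<psi> \<phi>. unit_vec d \<psi> \<Longrightarrow> unit_vec d \<phi> \<Longrightarrow> energy (prod_vec \<psi> \<phi>) \<ge> \<eta>"
  shows "hSep d Mop \<le> 1 - \<eta> / D"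
  unfolding hSep_def
proof (rule cSup_least)
  have "unit_vec d (\<lambda>i. of_bool (i = 0))"
  proof -
    have "(\<Sum>a<d. (cmod (of_bool (a = 0)))\<^sup>2) = (\<Sum>a<d. if a = 0 then 1 else 0)"
      by (intro sum.cong) auto
    then show ?thesis using d unfolding unit_vec_def by simp
  qed
  then show "{Re (tr_prod d 2 Mop (prod_pure \<psi> \<phi>)) |\<psi> \<phi>. unit_vec d \<psi> \<and> unit_vec d \<phi>} \<noteq> {}"
    by blast
next
  fix t assume "t \<in> {Re (tr_prod d 2 Mop (prod_pure \<psi> \<phi>)) |\<psi> \<phi>. unit_vec d \<psi> \<and> unit_vec d \<phi>}"
  then obtain \<psi> \<phi> where t: "t = Re (tr_prod d 2 Mop (prod_pure \<psi> \<phi>))" and u: "unit_vec d \<psi>" "unit_vec d \<phi>"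
    by blast
  have "prod_pure \<psi> \<phi> = (\<lambda>x y. prod_vec \<psi> \<phi> x * cnj (prod_vec \<psi> \<phi> y))"
    by (intro ext) (simp add: prod_pure_def prod_vec_def mult_ac)
  then have "t = (\<Sum>x\<in>idx d 2. (cmod (prod_vec \<psi> \<phi> x))\<^sup>2) - energy (prod_vec \<psi> \<phi>) / D"
    unfolding t by (simp add: qform_eq_tr_prod[symmetric] qform_Mop)
  also have "(\<Sum>x\<in>idx d 2. (cmod (prod_vec \<psi> \<phi> x))\<^sup>2) = 1"
    using u by (simp add: norm_prod_vec unit_vec_def)
  finally show "t \<le> 1 - \<eta> / D" using E[OF u] D_pos by (simp add: divide_right_mono)
qed

text \<open>Since \<open>lap\<close> is positive, no state exceeds one, and a state of zero energy
  attains it, so the supremum is a maximum.\<close>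

lemma DPS_eq_1:
  assumes k: "kext_ppt d k \<rho>" and z: "tr_prod d 2 lap \<rho> = 0"
  shows "DPS d k Mop = 1"
  unfolding DPS_def
proof (rule cSup_eq_maximum)
  have "tr_prod d 2 Mop \<rho> = 1"
    using k z by (simp add: tr_prod_Mop kext_ppt_def is_state_def)
  then show "1 \<in> {Re (tr_prod d 2 Mop \<rho>) |\<rho>. kext_ppt d k \<rho>}"
    using k by force
next
  fix t assume "t \<in> {Re (tr_prod d 2 Mop \<rho>) |\<rho>. kext_ppt d k \<rho>}"
  then obtain \<sigma> where t: "t = Re (tr_prod d 2 Mop \<sigma>)" and \<sigma>: "psd d 2 \<sigma>" "tr d 2 \<sigma> = 1"
    unfolding kext_ppt_def is_state_def by blast
  have "Re (tr_prod d 2 lap \<sigma>) \<ge> 0"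
    unfolding tr_prod_lap using Re_qform_psd[OF \<sigma>(1)] w_nonneg by (auto intro!: sum_nonneg)
  then show "t \<le> 1" unfolding t tr_prod_Mop using \<sigma> D_pos by simp
qed

end

section \<open>Robust soundness\<close>

lemma cmod_diff_square: "(cmod (a - b))\<^sup>2 = (cmod a)\<^sup>2 + (cmod b)\<^sup>2 - 2 * Re (a * cnj b)"
  unfolding cmod_power2 by (simp add: power2_eq_square algebra_simps)

lemma cmod_diff_square_le: "(cmod (a - b))\<^sup>2 \<le> 2 * (cmod a)\<^sup>2 + 2 * (cmod b)\<^sup>2"
proof -
  have "0 \<le> (cmod (a + b))\<^sup>2" by simp
  then show ?thesis unfolding cmod_power2 by (simp add: power2_eq_square algebra_simps)
qed

lemma sum_sq_diff_real:
  fixes a :: "nat \<Rightarrow> real"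
  shows "(\<Sum>i<N. \<Sum>j<N. (a i - a j)\<^sup>2) = 2 * real N * (\<Sum>i<N. (a i)\<^sup>2) - 2 * (\<Sum>i<N. a i)\<^sup>2"
proof -
  have "(\<Sum>i<N. \<Sum>j<N. (a i - a j)\<^sup>2) = (\<Sum>i<N. \<Sum>j<N. (a i)\<^sup>2 + (a j)\<^sup>2 - 2 * (a i * a j))"
    by (simp add: power2_diff mult.assoc)
  also have "\<dots> = real N * (\<Sum>i<N. (a i)\<^sup>2) + real N * (\<Sum>j<N. (a j)\<^sup>2) - 2 * (\<Sum>i<N. \<Sum>j<N. a i * a j)"
    by (simp add: sum.distrib sum_subtractf sum_distrib_left)
  also have "(\<Sum>i<N. \<Sum>j<N. a i * a j) = (\<Sum>i<N. a i)\<^sup>2"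
    by (simp add: power2_eq_square sum_product)
  finally show ?thesis by simp
qed

lemma sum_sq_dev_real:
  fixes a :: "nat \<Rightarrow> real"
  assumes "N > 0"
  shows "(\<Sum>i<N. (a i - (\<Sum>j<N. a j) / real N)\<^sup>2) = (\<Sum>i<N. (a i)\<^sup>2) - (\<Sum>i<N. a i)\<^sup>2 / real N"
proof -
  define S where "S = (\<Sum>j<N. a j)"
  have "(\<Sum>i<N. (a i - S / real N)\<^sup>2) = (\<Sum>i<N. (a i)\<^sup>2 + (S / real N)\<^sup>2 - 2 * (S / real N) * a i)"
    by (simp add: power2_diff mult_ac)
  also have "\<dots> = (\<Sum>i<N. (a i)\<^sup>2) + real N * (S / real N)\<^sup>2 - 2 * (S / real N) * S"
    by (simp add: sum.distrib sum_subtractf sum_distrib_left S_def)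
  also have "\<dots> = (\<Sum>i<N. (a i)\<^sup>2) - S\<^sup>2 / real N"
    using assms by (simp add: power2_eq_square field_simps)
  finally show ?thesis unfolding S_def .
qed

lemma sum_sq_diff_complex:
  fixes z :: "nat \<Rightarrow> complex"
  shows "(\<Sum>i<N. \<Sum>j<N. (cmod (z i - z j))\<^sup>2) = 2 * real N * (\<Sum>i<N. (cmod (z i))\<^sup>2) - 2 * (cmod (\<Sum>i<N. z i))\<^sup>2"
  using sum_sq_diff_real[of "\<lambda>i. Re (z i)" N] sum_sq_diff_real[of "\<lambda>i. Im (z i)" N]
  by (simp add: cmod_power2 sum.distrib algebra_simps)

lemma sum_sq_dev_complex:
  fixes z :: "nat \<Rightarrow> complex"
  assumes "N > 0"
  shows "(\<Sum>i<N. (cmod (z i - (\<Sum>j<N. z j) / of_nat N))\<^sup>2) =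
    (\<Sum>i<N. (cmod (z i))\<^sup>2) - (cmod (\<Sum>i<N. z i))\<^sup>2 / real N"
  using sum_sq_dev_real[OF assms, of "\<lambda>i. Re (z i)"] sum_sq_dev_real[OF assms, of "\<lambda>i. Im (z i)"]
  by (simp add: cmod_power2 sum.distrib add_divide_distrib Re_divide_of_nat Im_divide_of_nat)

text \<open>Lagrange's identity. It makes the antisymmetric energy of
  \<open>\<psi> \<otimes> \<phi>\<close> measure how far \<open>\<phi>\<close> is from a multiple of
  \<open>\<psi>\<close>.\<close>

lemma sum_sq_antisym:
  fixes \<psi> \<phi> :: "nat \<Rightarrow> complex"
  shows "(\<Sum>i<N. \<Sum>j<N. (cmod (\<psi> i * \<phi> j - \<psi> j * \<phi> i))\<^sup>2) =
    2 * (\<Sum>i<N. (cmod (\<psi> i))\<^sup>2) * (\<Sum>i<N. (cmod (\<phi> i))\<^sup>2) - 2 * (cmod (\<Sum>i<N. cnj (\<psi> i) * \<phi> i))\<^sup>2"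
proof -
  define \<omega> where "\<omega> = (\<Sum>i<N. cnj (\<psi> i) * \<phi> i)"
  have "(\<Sum>i<N. \<Sum>j<N. (cmod (\<psi> i * \<phi> j - \<psi> j * \<phi> i))\<^sup>2) =
    (\<Sum>i<N. \<Sum>j<N. (cmod (\<psi> i))\<^sup>2 * (cmod (\<phi> j))\<^sup>2 + (cmod (\<phi> i))\<^sup>2 * (cmod (\<psi> j))\<^sup>2
      - 2 * Re (cnj (cnj (\<psi> i) * \<phi> i) * (cnj (\<psi> j) * \<phi> j)))"
    unfolding cmod_diff_square by (simp add: norm_mult power_mult_distrib mult_ac)
  also have "\<dots> = (\<Sum>i<N. \<Sum>j<N. (cmod (\<psi> i))\<^sup>2 * (cmod (\<phi> j))\<^sup>2) +
      (\<Sum>i<N. \<Sum>j<N. (cmod (\<phi> i))\<^sup>2 * (cmod (\<psi> j))\<^sup>2)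
      - 2 * (\<Sum>i<N. \<Sum>j<N. Re (cnj (cnj (\<psi> i) * \<phi> i) * (cnj (\<psi> j) * \<phi> j)))"
    by (simp only: sum.distrib sum_subtractf sum_distrib_left)
  also have "(\<Sum>i<N. \<Sum>j<N. Re (cnj (cnj (\<psi> i) * \<phi> i) * (cnj (\<psi> j) * \<phi> j))) = Re (cnj \<omega> * \<omega>)"
    unfolding \<omega>_def cnj_sum sum_product Re_sum ..
  also have "Re (cnj \<omega> * \<omega>) = (cmod \<omega>)\<^sup>2"
    unfolding cmod_power2 by (simp add: power2_eq_square)
  finally show ?thesis unfolding sum_product[symmetric] \<omega>_def by simp
qed

text \<open>Pythagoras for the projection of \<open>\<phi>\<close> onto the unit vector
  \<open>\<psi>\<close>.\<close>

lemma sum_sq_residual: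
  fixes \<psi> \<phi> :: "nat \<Rightarrow> complex"
  assumes \<psi>: "(\<Sum>i<N. (cmod (\<psi> i))\<^sup>2) = 1" and \<omega>: "\<omega> = (\<Sum>i<N. cnj (\<psi> i) * \<phi> i)"
  shows "(\<Sum>i<N. (cmod (\<phi> i - \<omega> * \<psi> i))\<^sup>2) = (\<Sum>i<N. (cmod (\<phi> i))\<^sup>2) - (cmod \<omega>)\<^sup>2"
proof -
  have "(\<Sum>i<N. (cmod (\<phi> i - \<omega> * \<psi> i))\<^sup>2) =
    (\<Sum>i<N. (cmod (\<phi> i))\<^sup>2 + (cmod \<omega>)\<^sup>2 * (cmod (\<psi> i))\<^sup>2 - 2 * Re (cnj \<omega> * (cnj (\<psi> i) * \<phi> i)))"
    unfolding cmod_diff_square by (simp add: norm_mult power_mult_distrib mult_ac)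
  also have "\<dots> = (\<Sum>i<N. (cmod (\<phi> i))\<^sup>2) + (cmod \<omega>)\<^sup>2 - 2 * Re (cnj \<omega> * \<omega>)"
    unfolding sum.distrib sum_subtractf sum_distrib_left[symmetric] Re_sum[symmetric] \<psi> \<omega>[symmetric]
    by simp
  also have "Re (cnj \<omega> * \<omega>) = (cmod \<omega>)\<^sup>2"
    unfolding cmod_power2 by (simp add: power2_eq_square)
  finally show ?thesis by simp
qed

text \<open>Products of perturbed signs: \<open>\<psi> = \<nu>(x + e)\<close> with \<open>|e| \<le> 1/5\<close>.\<close>
lemma violated_constraint_lower:
  fixes x :: "nat \<Rightarrow> real"
  assumes near: "\<And>a. a \<in> {i, j, k, l} \<Longrightarrow> cmod (\<psi> a - of_real (x a) * \<nu>) \<le> cmod \<nu> / 5"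
    and sq: "\<And>a. a \<in> {i, j, k, l} \<Longrightarrow> x a * x a = 1"
    and b: "b * b = 1" and viol: "b * (x i * x j * (x k * x l)) = -1"
  shows "cmod (\<nu>\<^sup>2) \<le> cmod (\<psi> i * \<psi> j - of_real b * (\<psi> k * \<psi> l))"
proof (cases "\<nu> = 0")
  case False
  define e where "e a = \<psi> a / \<nu> - of_real (x a)" for a
  have \<psi>: "\<psi> a = \<nu> * (of_real (x a) + e a)" for a using False by (simp add: e_def)
  have e: "cmod (e a) \<le> 1 / 5" if "a \<in> {i, j, k, l}" for a
  proof -
    have "\<nu> * e a = \<psi> a - of_real (x a) * \<nu>" unfolding \<psi>[of a] by (simp add: algebra_simps)
    then have "cmod \<nu> * cmod (e a) \<le> cmod \<nu> * (1 / 5)"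
      using near[OF that] by (simp flip: norm_mult)
    then show ?thesis using False by simp
  qed
  have one: "\<bar>c\<bar> = 1" if "c * c = 1" for c :: real
    using that by (metis abs_square_eq_1 power2_eq_square)
  \<comment> \<open>\<open>r a c\<close> is the error in
    \<open>(x a + e a) * (x c + e c) = x a * x c + r a c\<close>; its bound is
    \<open>11/25 = 2/5 + 1/25\<close>.\<close>
  define r where "r a c = of_real (x a) * e c + e a * of_real (x c) + e a * e c" for a c
  have r: "cmod (r a c) \<le> 11 / 25" if "a \<in> {i, j, k, l}" "c \<in> {i, j, k, l}" for a c
  proof -
    have "cmod (r a c) \<le> cmod (of_real (x a) * e c) + cmod (e a * of_real (x c)) + cmod (e a * e c)"
      unfolding r_def by (intro norm_triangle_le add_mono norm_triangle_ineq order_refl)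
    also have "\<dots> \<le> 1 / 5 + 1 / 5 + 1 / 5 * (1 / 5)"
      unfolding norm_mult norm_of_real using one[OF sq] e that
      by (intro add_mono mult_mono) auto
    finally show ?thesis by simp
  qed
  have neg: "b * (x k * x l) = - (x i * x j)"
  proof -
    have "x i * x j * (b * (x i * x j * (x k * x l))) = (x i * x i) * (x j * x j) * (b * (x k * x l))"
      by (simp add: mult_ac)
    then show ?thesis unfolding viol using sq by simp
  qed
  have "\<psi> i * \<psi> j - of_real b * (\<psi> k * \<psi> l) =
    \<nu>\<^sup>2 * (of_real (x i * x j - b * (x k * x l)) + (r i j - of_real b * r k l))"
    unfolding \<psi> r_def by (simp add: algebra_simps power2_eq_square)
  also have "x i * x j - b * (x k * x l) = 2 * (x i * x j)" unfolding neg by simp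
  finally have eq: "cmod (\<psi> i * \<psi> j - of_real b * (\<psi> k * \<psi> l)) =
    cmod (\<nu>\<^sup>2) * cmod (of_real (2 * (x i * x j)) + (r i j - of_real b * r k l))"
    by (simp only: norm_mult)
  have "cmod (r i j - of_real b * r k l) \<le> cmod (r i j) + cmod (of_real b * r k l)"
    by (rule norm_triangle_ineq4)
  also have "\<dots> \<le> 11 / 25 + 11 / 25"
    unfolding norm_mult norm_of_real one[OF b] using r by (intro add_mono) auto
  finally have small: "cmod (r i j - of_real b * r k l) \<le> 22 / 25" by simp
  \<comment> \<open>A violated constraint makes the main terms add up to modulus 2, and the two
    errors take away at most 22/25, leaving more than 1.\<close>
  have "2 - 22 / 25 \<le> cmod (of_real (2 * (x i * x j)) :: complex) - cmod (r i j - of_real b * r k l)"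
  proof -
    have "cmod (of_real (2 * (x i * x j)) :: complex) = 2 * (\<bar>x i\<bar> * \<bar>x j\<bar>)"
      unfolding norm_of_real abs_mult by simp
    then show ?thesis using small one[OF sq, of i] one[OF sq, of j] by simp
  qed
  also have "\<dots> \<le> cmod (of_real (2 * (x i * x j)) + (r i j - of_real b * r k l))"
    by (rule norm_diff_ineq)
  finally have "1 \<le> cmod (of_real (2 * (x i * x j)) + (r i j - of_real b * r k l))" by simp
  then show ?thesis unfolding eq using mult_left_mono[of 1 _ "cmod (\<nu>\<^sup>2)"] by simp
qed simp

text \<open>\<open>violated\<close> is robust unsatisfiability: the value 0 marks a discarded
  variable, and a constraint that contains one has product 0 and is not counted.
  \<open>s \<ge> 5\<close> lets expansion be applied to five constraints.\<close>

locale xor_instance = xor_expander +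
  assumes N_pos: "N > 0" and s_ge: "s \<ge> 5"
    and violated: "\<And>x :: nat \<Rightarrow> real. (\<And>i. i < N \<Longrightarrow> x i \<in> {-1, 0, 1}) \<Longrightarrow>
      20 * card {i. i < N \<and> x i = 0} \<le> N \<Longrightarrow>
      N \<le> card {c. c < m \<and> b c * prod_list (map x (f c)) = -1}"
begin

text \<open>The three summands stand for \<open>x_i y_i = x_j y_j\<close>, for the XOR constraints and for
  \<open>x_i y_j = x_j y_i\<close>. The weight \<open>1/(2N)\<close> turns the first kind into the total squared
  deviation of the \<open>x_i y_i\<close> from their mean.\<close>
definition edges :: "(nat \<times> nat + nat + nat \<times> nat) set" where
  "edges = ({..<N} \<times> {..<N}) <+> ({..<m} <+> ({..<N} \<times> {..<N}))"

definition weight :: "nat \<times> nat + nat + nat \<times> nat \<Rightarrow> real" where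
  "weight = case_sum (\<lambda>_. 1 / (2 * real N)) (\<lambda>_. 1)"

definition sgn_edge :: "nat \<times> nat + nat + nat \<times> nat \<Rightarrow> real" where
  "sgn_edge = case_sum (\<lambda>_. 1) (case_sum b (\<lambda>_. 1))"

text \<open>Splitting a constraint after two positions makes both of its sides quadratic in
  \<open>x\<close>, hence linear in the coordinates of a two-party vector.\<close>

definition src :: "nat \<times> nat + nat + nat \<times> nat \<Rightarrow> nat list" where
  "src = case_sum (\<lambda>(i, j). [i, i]) (case_sum (\<lambda>c. take 2 (f c)) (\<lambda>(i, j). [i, j]))"

definition tgt :: "nat \<times> nat + nat + nat \<times> nat \<Rightarrow> nat list" where
  "tgt = case_sum (\<lambda>(i, j). [j, j]) (case_sum (\<lambda>c. drop 2 (f c)) (\<lambda>(i, j). [j, i]))"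

lemma f_obtain:
  assumes "c < m"
  obtains i j k l where "f c = [i, j, k, l]" "i < N" "j < N" "k < N" "l < N"
  using f_idx[OF assms] that
  by (auto simp: idx_def numeral_eq_Suc length_Suc_conv)

lemma take_drop_idx:
  assumes "c < m"
  shows "take 2 (f c) \<in> idx N 2" "drop 2 (f c) \<in> idx N 2"
  by (rule f_obtain[OF assms]; simp add: idx_def)+

lemma sgn_edge_sq: "r \<in> edges \<Longrightarrow> sgn_edge r * sgn_edge r = 1"
  by (auto simp: edges_def sgn_edge_def b_sq)

sublocale bipartite_signed_graph N edges weight sgn_edge src tgt 22
proof unfold_locales
  fix r assume r: "r \<in> edges"
  show "weight r \<ge> 0" by (cases r) (auto simp: weight_def)
  have pair: "[i, j] \<in> idx N 2" if "i < N" "j < N" for i j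
    using that by (simp add: idx_def)
  show "src r \<in> idx N 2" "tgt r \<in> idx N 2"
    using r take_drop_idx by (auto simp: edges_def src_def tgt_def pair)
qed (auto simp: edges_def)

lemma energy_eq:
  "energy v = (\<Sum>i<N. \<Sum>j<N. (cmod (v [i, i] - v [j, j]))\<^sup>2) / (2 * real N) +
    (\<Sum>c<m. (cmod (v (take 2 (f c)) - of_real (b c) * v (drop 2 (f c))))\<^sup>2) +
    (\<Sum>i<N. \<Sum>j<N. (cmod (v [i, j] - v [j, i]))\<^sup>2)"
proof -
  have "energy v = (\<Sum>r\<in>{..<N} \<times> {..<N}. (1 / (2 * real N)) *
      (cmod (v (case r of (i, j) \<Rightarrow> [i, i]) - v (case r of (i, j) \<Rightarrow> [j, j])))\<^sup>2) +
    ((\<Sum>c<m. (cmod (v (take 2 (f c)) - of_real (b c) * v (drop 2 (f c))))\<^sup>2) +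
    (\<Sum>r\<in>{..<N} \<times> {..<N}. (cmod (v (case r of (i, j) \<Rightarrow> [i, j]) - v (case r of (i, j) \<Rightarrow> [j, i])))\<^sup>2))"
    unfolding energy_def
    unfolding edges_def
    by (simp add: sum.Plus weight_def sgn_edge_def src_def tgt_def)
  also have "(\<Sum>r\<in>{..<N} \<times> {..<N}. (1 / (2 * real N)) *
      (cmod (v (case r of (i, j) \<Rightarrow> [i, i]) - v (case r of (i, j) \<Rightarrow> [j, j])))\<^sup>2) =
    (\<Sum>i<N. \<Sum>j<N. (cmod (v [i, i] - v [j, j]))\<^sup>2) / (2 * real N)"
    unfolding sum_distrib_left[symmetric] by (simp add: sum.cartesian_product split_def)
  also have "(\<Sum>r\<in>{..<N} \<times> {..<N}. (cmod (v (case r of (i, j) \<Rightarrow> [i, j]) - v (case r of (i, j) \<Rightarrow> [j, i])))\<^sup>2) =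
    (\<Sum>i<N. \<Sum>j<N. (cmod (v [i, j] - v [j, i]))\<^sup>2)"
    by (simp add: sum.cartesian_product split_def)
  finally show ?thesis by simp
qed

text \<open>On every edge, \<open>L\<close> of the product of the two monomials equals the sign
  \<open>\<beta>\<close>, so the quadratic form at the edge vector is proportional to
  \<open>1 - 2 * \<beta>^2 + \<beta>^2\<close>, which is zero as
  \<open>\<beta>^2 = 1\<close>.\<close>

lemma tr_prod_lap_rho: "tr_prod N 2 lap (rho 2) = 0"
proof -
  have key: "L (par (src r @ tgt r)) = sgn_edge r" if r: "r \<in> edges" for r
  proof -
    have *: "par ([i, i] @ [j, j]) = {}" "par ([i, j] @ [j, i]) = {}" for i j
      by (auto simp: par_def)
    show ?thesis using r s_ge
      by (auto simp: edges_def src_def tgt_def sgn_edge_def * L_empty L_constraint simp del: append.simps)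
  qed
  have "qform N 2 (rho 2) (edge_vec (src r) (tgt r) (sgn_edge r)) = 0" if r: "r \<in> edges" for r
  proof -
    have comm: "par (tgt r @ src r) = par (src r @ tgt r)" unfolding par_append by auto
    have "par (x @ x) = {}" for x unfolding par_append by auto
    then show ?thesis
      unfolding qform_edge_vec[OF p_idx[OF r] q_idx[OF r]] rho_def comm key[OF r]
      using sgn_edge_sq[OF r] by (simp add: L_empty power2_eq_square flip: of_real_mult)
  qed
  then show ?thesis unfolding tr_prod_lap by simp
qed

text \<open>Five constraints sharing two of their four positions would see at most twelve variables,
  contradicting expansion.\<close>
lemma card_shared_pair_le:
  assumes x: "length x = 2" and g: "\<And>c. c < m \<Longrightarrow> length (g c) = 2"
    and T: "T \<subseteq> {..<m}" "\<And>c. c \<in> T \<Longrightarrow> set (f c) \<subseteq> set x \<union> set (g c)"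
  shows "card T \<le> 4"
proof (rule ccontr)
  assume "\<not> card T \<le> 4"
  then obtain U where U: "U \<subseteq> T" "card U = 5" "finite U"
    by (metis not_less_eq_eq numeral_eq_Suc obtain_subset_with_card_n pred_numeral_simps(2,3) semiring_norm(26,27,28))
  have "card (\<Union>c\<in>U. set (f c)) \<le> card (set x \<union> (\<Union>c\<in>U. set (g c)))"
    using U T(2) by (intro card_mono) (simp, fastforce)
  also have "\<dots> \<le> card (set x) + card (\<Union>c\<in>U. set (g c))" by (rule card_Un_le)
  also have "\<dots> \<le> 2 + (\<Sum>c\<in>U. card (set (g c)))"
    using card_length[of x] x card_UN_le[OF U(3)] by (intro add_mono) auto
  also have "(\<Sum>c\<in>U. card (set (g c))) \<le> (\<Sum>c\<in>U. 2)"
    using U T g by (intro sum_mono) (metis card_length lessThan_iff subsetD)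
  finally have "card (\<Union>c\<in>U. set (f c)) \<le> 12" using U by simp
  \<comment> \<open>Twelve variables are too few for five constraints, since
    \<open>25 \<le> 2 * 12\<close> fails.\<close>
  moreover have "5 * card U \<le> 2 * card (\<Union>c\<in>U. set (f c))"
    using U T s_ge by (intro expansion) auto
  ultimately show False using U by simp
qed

text \<open>By \<open>card_shared_pair_le\<close> a pair is the first half of at most four
  constraints, and likewise the second half, so no basis vector is charged more than four
  times.\<close>

lemma sum_constraints_le:
  fixes h :: "nat list \<Rightarrow> real"
  assumes h: "\<And>x. h x \<ge> 0" and g: "g = (\<lambda>c. take 2 (f c)) \<or> g = (\<lambda>c. drop 2 (f c))"
  shows "(\<Sum>c<m. h (g c)) \<le> 4 * (\<Sum>x\<in>idx N 2. h x)"
proof -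
  have img: "g ` {..<m} \<subseteq> idx N 2" using g take_drop_idx by auto
  have "(\<Sum>c<m. h (g c)) = (\<Sum>x\<in>idx N 2. \<Sum>c\<in>{c \<in> {..<m}. g c = x}. h (g c))"
    by (rule sum.group[symmetric]) (use img in auto)
  also have "\<dots> = (\<Sum>x\<in>idx N 2. real (card {c \<in> {..<m}. g c = x}) * h x)"
    by simp
  also have "\<dots> \<le> (\<Sum>x\<in>idx N 2. 4 * h x)"
  proof (intro sum_mono mult_right_mono h)
    fix x assume x: "x \<in> idx N 2"
    have un: "set (f c) = set (take 2 (f c)) \<union> set (drop 2 (f c))" for c
      by (metis append_take_drop_id set_append)
    have len: "length (take 2 (f c)) = 2" "length (drop 2 (f c)) = 2" if "c < m" for c
      using take_drop_idx[OF that] by (simp_all add: idx_def)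
    from g have "card {c \<in> {..<m}. g c = x} \<le> 4"
    proof
      assume g: "g = (\<lambda>c. take 2 (f c))"
      show ?thesis
        by (rule card_shared_pair_le[where x = x and g = "\<lambda>c. drop 2 (f c)"])
          (use x un len in \<open>auto simp: g idx_def\<close>)
    next
      assume g: "g = (\<lambda>c. drop 2 (f c))"
      show ?thesis
        by (rule card_shared_pair_le[where x = x and g = "\<lambda>c. take 2 (f c)"])
          (use x un len in \<open>auto simp: g idx_def\<close>)
    qed
    then show "real (card {c \<in> {..<m}. g c = x}) \<le> 4" by simp
  qed
  finally show ?thesis by (simp add: sum_distrib_left)
qed

text \<open>The diagonal edges contribute at most 1, the XOR edges \<open>2 * 4 + 2 * 4 = 16\<close>
  and the antisymmetric edges 4 times the squared norm. This makes \<open>Mop\<close>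
  positive.\<close>

lemma energy_le: "energy v \<le> 22 * (\<Sum>x\<in>idx N 2. (cmod (v x))\<^sup>2)"
proof -
  define S where "S = (\<Sum>x\<in>idx N 2. (cmod (v x))\<^sup>2)"
  have S: "S = (\<Sum>i<N. \<Sum>j<N. (cmod (v [i, j]))\<^sup>2)" unfolding S_def by (rule sum_idx_two)
  have diag: "(\<Sum>i<N. (cmod (v [i, i]))\<^sup>2) \<le> S"
    unfolding S by (intro sum_mono member_le_sum) auto
  have "(\<Sum>i<N. \<Sum>j<N. (cmod (v [i, i] - v [j, j]))\<^sup>2) \<le> 2 * real N * (\<Sum>i<N. (cmod (v [i, i]))\<^sup>2)"
    unfolding sum_sq_diff_complex[of "\<lambda>i. v [i, i]"] by simp
  also have "\<dots> \<le> 2 * real N * S" using diag by (intro mult_left_mono) auto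
  finally have 1: "(\<Sum>i<N. \<Sum>j<N. (cmod (v [i, i] - v [j, j]))\<^sup>2) / (2 * real N) \<le> S"
    using N_pos by (simp add: field_simps)
  have b1: "\<bar>b c\<bar> = 1" if "c < m" for c
    using b_sq[OF that] by (metis abs_square_eq_1 power2_eq_square)
  have "(\<Sum>c<m. (cmod (v (take 2 (f c)) - of_real (b c) * v (drop 2 (f c))))\<^sup>2) \<le>
    (\<Sum>c<m. 2 * (cmod (v (take 2 (f c))))\<^sup>2 + 2 * (cmod (v (drop 2 (f c))))\<^sup>2)"
  proof (rule sum_mono)
    fix c assume "c \<in> {..<m}"
    then have "cmod (of_real (b c) * v (drop 2 (f c))) = cmod (v (drop 2 (f c)))"
      using b1 by (simp add: norm_mult)
    then show "(cmod (v (take 2 (f c)) - of_real (b c) * v (drop 2 (f c))))\<^sup>2 \<le>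
        2 * (cmod (v (take 2 (f c))))\<^sup>2 + 2 * (cmod (v (drop 2 (f c))))\<^sup>2"
      using cmod_diff_square_le[of "v (take 2 (f c))" "of_real (b c) * v (drop 2 (f c))"] by simp
  qed
  also have "\<dots> = 2 * (\<Sum>c<m. (cmod (v (take 2 (f c))))\<^sup>2) + 2 * (\<Sum>c<m. (cmod (v (drop 2 (f c))))\<^sup>2)"
    by (simp add: sum.distrib sum_distrib_left)
  also have "\<dots> \<le> 2 * (4 * S) + 2 * (4 * S)"
    unfolding S_def
    using sum_constraints_le[of "\<lambda>x. (cmod (v x))\<^sup>2" "\<lambda>c. take 2 (f c)"]
      sum_constraints_le[of "\<lambda>x. (cmod (v x))\<^sup>2" "\<lambda>c. drop 2 (f c)"]
    by (intro add_mono mult_left_mono) auto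
  finally have 2: "(\<Sum>c<m. (cmod (v (take 2 (f c)) - of_real (b c) * v (drop 2 (f c))))\<^sup>2) \<le> 16 * S"
    by simp
  have "(\<Sum>i<N. \<Sum>j<N. (cmod (v [i, j] - v [j, i]))\<^sup>2) \<le>
      (\<Sum>i<N. \<Sum>j<N. 2 * (cmod (v [i, j]))\<^sup>2 + 2 * (cmod (v [j, i]))\<^sup>2)"
    by (intro sum_mono cmod_diff_square_le)
  also have "\<dots> = 2 * S + 2 * (\<Sum>i<N. \<Sum>j<N. (cmod (v [j, i]))\<^sup>2)"
    by (simp add: sum.distrib sum_distrib_left S)
  also have "(\<Sum>i<N. \<Sum>j<N. (cmod (v [j, i]))\<^sup>2) = S"
    unfolding S by (rule sum.swap)
  finally have 3: "(\<Sum>i<N. \<Sum>j<N. (cmod (v [i, j] - v [j, i]))\<^sup>2) \<le> 4 * S" by simp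
  have "S \<ge> 0" unfolding S_def by (simp add: sum_nonneg)
  then show ?thesis unfolding energy_eq S_def[symmetric] using 1 2 3 by linarith
qed

text \<open>If the energy were small, the diagonal edges would put most \<open>\<psi> i\<close> near
  \<open>\<plusminus>\<nu>\<close> for a common \<open>\<nu>\<close>. Rounding to signs leaves at
  least \<open>N\<close> violated constraints, each costing
  \<open>(cmod \<mu>)^2 \<ge> 1/(2 * N^2)\<close>, a total of at least
  \<open>1/(2 * N)\<close>.\<close>

lemma energy_square_ge:
  assumes unit: "unit_vec N \<psi>"
  shows "energy (prod_vec \<psi> \<psi>) \<ge> 1 / (25000 * real N)"
proof (rule ccontr)
  assume "\<not> ?thesis"
  then have less: "energy (prod_vec \<psi> \<psi>) < 1 / (25000 * real N)" by simp
  define z where "z i = (\<psi> i)\<^sup>2" for i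
  define \<mu> where "\<mu> = (\<Sum>i<N. z i) / of_nat N"
  define e2 where "e2 = (\<Sum>c<m. (cmod (prod_vec \<psi> \<psi> (take 2 (f c)) - of_real (b c) * prod_vec \<psi> \<psi> (drop 2 (f c))))\<^sup>2)"
  have N: "real N > 0" using N_pos by simp
  have energy: "energy (prod_vec \<psi> \<psi>) = (\<Sum>i<N. \<Sum>j<N. (cmod (z i - z j))\<^sup>2) / (2 * real N) + e2"
    unfolding energy_eq e2_def z_def by (simp add: prod_vec_def power2_eq_square mult.commute)
  have "(\<Sum>i<N. \<Sum>j<N. (cmod (z i - z j))\<^sup>2) / (2 * real N) = (\<Sum>i<N. (cmod (z i - \<mu>))\<^sup>2)"
    unfolding \<mu>_def sum_sq_diff_complex sum_sq_dev_complex[OF N_pos] using N by (simp add: field_simps)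
  moreover have "e2 \<ge> 0" unfolding e2_def by (intro sum_nonneg) auto
  moreover have "(\<Sum>i<N. (cmod (z i - \<mu>))\<^sup>2) \<ge> 0" by (intro sum_nonneg) auto
  ultimately have dev: "(\<Sum>i<N. (cmod (z i - \<mu>))\<^sup>2) < 1 / (25000 * real N)"
    and e2: "e2 < 1 / (25000 * real N)"
    using less unfolding energy by linarith+
  \<comment> \<open>The \<open>cmod (z i)\<close> sum to one, so by Cauchy-Schwarz their squares sum
    to at least \<open>1/N\<close>. The small deviation leaves at least half of this to the
    mean.\<close>
  have mu: "(cmod \<mu>)\<^sup>2 \<ge> 1 / (2 * (real N)\<^sup>2)"
  proof -
    have "0 \<le> (\<Sum>i<N. \<Sum>j<N. ((cmod (\<psi> i))\<^sup>2 - (cmod (\<psi> j))\<^sup>2)\<^sup>2)" by (intro sum_nonneg) auto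
    also have "\<dots> = 2 * real N * (\<Sum>i<N. (cmod (z i))\<^sup>2) - 2"
      using unit unfolding sum_sq_diff_real unit_vec_def z_def by (simp add: norm_power)
    finally have "1 / real N \<le> (\<Sum>i<N. (cmod (z i))\<^sup>2)" using N by (simp add: field_simps)
    moreover have "(cmod (\<Sum>i<N. z i))\<^sup>2 / real N = real N * (cmod \<mu>)\<^sup>2"
      unfolding \<mu>_def using N by (simp add: norm_divide power_divide field_simps power2_eq_square)
    ultimately have "1 / real N - real N * (cmod \<mu>)\<^sup>2 < 1 / (25000 * real N)"
      using dev sum_sq_dev_complex[OF N_pos, of z] unfolding \<mu>_def[symmetric] by linarith
    moreover have "1 / real N - 1 / (25000 * real N) \<ge> 1 / (2 * real N)" using N by (simp add: field_simps)
    ultimately have "1 / (2 * real N) \<le> real N * (cmod \<mu>)\<^sup>2" by linarith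
    then show ?thesis using N by (simp add: field_simps power2_eq_square)
  qed
  \<comment> \<open>The threshold 1/25 becomes 1/5 after taking square roots. Chebyshev's inequality
    with \<open>25^2/25000 = 1/40\<close> gives \<open>card B \<le> N/20\<close>.\<close>
  define B where "B = {i. i < N \<and> cmod (z i - \<mu>) > cmod \<mu> / 25}"
  have "real (card B) * ((cmod \<mu>)\<^sup>2 / 625) = (\<Sum>i\<in>B. (cmod \<mu> / 25)\<^sup>2)"
    by (simp add: power_divide)
  also have "\<dots> \<le> (\<Sum>i\<in>B. (cmod (z i - \<mu>))\<^sup>2)"
    by (intro sum_mono power_mono) (auto simp: B_def)
  also have "\<dots> \<le> (\<Sum>i<N. (cmod (z i - \<mu>))\<^sup>2)"
    by (intro sum_mono2) (auto simp: B_def)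
  also note dev
  finally have B1: "real (card B) * (cmod \<mu>)\<^sup>2 \<le> 1 / (40 * real N)" by simp
  have "real (card B) * (1 / (2 * (real N)\<^sup>2)) \<le> real (card B) * (cmod \<mu>)\<^sup>2"
    using mu by (intro mult_left_mono) auto
  with B1 have "real (card B) * (1 / (2 * (real N)\<^sup>2)) \<le> 1 / (40 * real N)" by linarith
  then have "20 * real (card B) \<le> real N" using N by (simp add: field_simps power2_eq_square)
  then have cardB: "20 * card B \<le> N" by linarith
  define \<nu> where "\<nu> = csqrt \<mu>"
  have \<nu>: "\<nu>\<^sup>2 = \<mu>" unfolding \<nu>_def by simp
  \<comment> \<open>Round to the nearer of the two square roots of \<open>\<mu>\<close>; 0 discards
    the variable.\<close>
  define x :: "nat \<Rightarrow> real" where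
    "x i = (if i \<in> B then 0 else if cmod (\<psi> i - \<nu>) \<le> cmod (\<psi> i + \<nu>) then 1 else -1)" for i
  have near: "cmod (\<psi> i - of_real (x i) * \<nu>) \<le> cmod \<nu> / 5" if "i < N" "i \<notin> B" for i
  proof -
    \<comment> \<open>The square of the smaller distance is at most the product of both, which is
      \<open>cmod (z i - \<mu>)\<close>.\<close>
    have "(cmod (\<psi> i - of_real (x i) * \<nu>))\<^sup>2 \<le> cmod (\<psi> i - \<nu>) * cmod (\<psi> i + \<nu>)"
      using that(2) unfolding power2_eq_square x_def by (auto intro: mult_mono)
    also have "\<dots> = cmod (z i - \<mu>)"
      unfolding norm_mult[symmetric] z_def \<nu>[symmetric] by (simp add: power2_eq_square algebra_simps)
    also have "\<dots> \<le> cmod \<mu> / 25" using that unfolding B_def by auto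
    also have "\<dots> = (cmod \<nu> / 5)\<^sup>2" unfolding \<nu>[symmetric] by (simp add: norm_power power_divide)
    finally show ?thesis by (rule power2_le_imp_le) simp
  qed
  have "{i. i < N \<and> x i = 0} = B" by (auto simp: x_def B_def)
  then have viol: "N \<le> card {c. c < m \<and> b c * prod_list (map x (f c)) = -1}" (is "_ \<le> card ?V")
    using cardB by (intro violated) (auto simp: x_def)
  have lower: "(cmod \<mu>)\<^sup>2 \<le> (cmod (prod_vec \<psi> \<psi> (take 2 (f c)) - of_real (b c) * prod_vec \<psi> \<psi> (drop 2 (f c))))\<^sup>2"
    if "c \<in> ?V" for c
  proof -
    have c: "c < m" and v: "b c * prod_list (map x (f c)) = -1" using that by auto
    obtain i j k l where fc: "f c = [i, j, k, l]" and lt: "i < N" "j < N" "k < N" "l < N"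
      using f_obtain[OF c] .
    have v': "b c * (x i * x j * (x k * x l)) = -1" using v by (simp add: fc mult_ac)
    then have nz: "a \<notin> B" if "a \<in> {i, j, k, l}" for a
      using that by (auto simp: x_def)
    have "cmod (\<nu>\<^sup>2) \<le> cmod (\<psi> i * \<psi> j - of_real (b c) * (\<psi> k * \<psi> l))"
    proof (rule violated_constraint_lower[OF _ _ b_sq[OF c] v'])
      fix a assume a: "a \<in> {i, j, k, l}"
      show "cmod (\<psi> a - of_real (x a) * \<nu>) \<le> cmod \<nu> / 5"
        using a nz[OF a] lt by (intro near) auto
      show "x a * x a = 1" using nz[OF a] by (simp add: x_def)
    qed
    then show ?thesis unfolding \<nu> by (intro power_mono) (auto simp: prod_vec_def fc)
  qed
  have "real N * (cmod \<mu>)\<^sup>2 \<le> real (card ?V) * (cmod \<mu>)\<^sup>2"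
    using viol by (intro mult_right_mono) auto
  also have "\<dots> = (\<Sum>c\<in>?V. (cmod \<mu>)\<^sup>2)" by simp
  also have "\<dots> \<le> (\<Sum>c\<in>?V. (cmod (prod_vec \<psi> \<psi> (take 2 (f c)) - of_real (b c) * prod_vec \<psi> \<psi> (drop 2 (f c))))\<^sup>2)"
    using lower by (rule sum_mono)
  also have "\<dots> \<le> e2" unfolding e2_def by (intro sum_mono2) auto
  finally have "real N * (cmod \<mu>)\<^sup>2 \<le> e2" .
  moreover have "real N * (1 / (2 * (real N)\<^sup>2)) \<le> real N * (cmod \<mu>)\<^sup>2"
    using mu by (intro mult_left_mono) auto
  moreover have "real N * (1 / (2 * (real N)\<^sup>2)) = 1 / (2 * real N)"
    using N by (simp add: power2_eq_square)
  moreover have "1 / (25000 * real N) \<le> 1 / (2 * real N)" using N by (simp add: field_simps)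
  ultimately show False using e2 by linarith
qed

section \<open>From squares to arbitrary product vectors\<close>

lemma energy_diff_le: "energy (\<lambda>x. u x - v x) \<le> 2 * energy u + 2 * energy v"
proof -
  have "energy (\<lambda>x. u x - v x) \<le> (\<Sum>r\<in>edges. weight r *
      (2 * (cmod (u (src r) - of_real (sgn_edge r) * u (tgt r)))\<^sup>2 +
       2 * (cmod (v (src r) - of_real (sgn_edge r) * v (tgt r)))\<^sup>2))"
    unfolding energy_def
  proof (intro sum_mono mult_left_mono w_nonneg)
    fix r
    have eq: "u (src r) - v (src r) - of_real (sgn_edge r) * (u (tgt r) - v (tgt r)) =
      (u (src r) - of_real (sgn_edge r) * u (tgt r)) - (v (src r) - of_real (sgn_edge r) * v (tgt r))"
      by (simp add: algebra_simps)
    show "(cmod (u (src r) - v (src r) - of_real (sgn_edge r) * (u (tgt r) - v (tgt r))))\<^sup>2 \<le>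
      2 * (cmod (u (src r) - of_real (sgn_edge r) * u (tgt r)))\<^sup>2 +
      2 * (cmod (v (src r) - of_real (sgn_edge r) * v (tgt r)))\<^sup>2"
      unfolding eq by (rule cmod_diff_square_le)
  qed
  then show ?thesis
    unfolding energy_def by (simp add: distrib_left sum.distrib sum_distrib_left mult_ac)
qed

lemma energy_scale: "energy (\<lambda>x. c * v x) = (cmod c)\<^sup>2 * energy v"
proof -
  have "(cmod (c * v (src r) - of_real (sgn_edge r) * (c * v (tgt r))))\<^sup>2 =
    (cmod c)\<^sup>2 * (cmod (v (src r) - of_real (sgn_edge r) * v (tgt r)))\<^sup>2" for r
  proof -
    have "c * v (src r) - of_real (sgn_edge r) * (c * v (tgt r)) =
      c * (v (src r) - of_real (sgn_edge r) * v (tgt r))" by (simp add: algebra_simps)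
    then show ?thesis by (simp add: norm_mult power_mult_distrib)
  qed
  then show ?thesis unfolding energy_def by (simp add: sum_distrib_left mult_ac)
qed

text \<open>The antisymmetric edges force \<open>\<phi>\<close> to be almost proportional to \<open>\<psi>\<close>.\<close>
lemma energy_prod_ge:
  assumes unit: "unit_vec N \<psi>" "unit_vec N \<phi>"
  shows "energy (prod_vec \<psi> \<phi>) \<ge> 1 / (1200000 * real N)"
proof (rule ccontr)
  assume "\<not> ?thesis"
  then have less: "energy (prod_vec \<psi> \<phi>) < 1 / (1200000 * real N)" by simp
  have N: "real N \<ge> 1" using N_pos by simp
  \<comment> \<open>\<open>\<omega>\<close> is the overlap and \<open>\<delta>\<close> the component
    of \<open>\<phi>\<close> orthogonal to \<open>\<psi>\<close>.\<close>
  define \<omega> where "\<omega> = (\<Sum>i<N. cnj (\<psi> i) * \<phi> i)"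
  define \<delta> where "\<delta> i = \<phi> i - \<omega> * \<psi> i" for i
  have "(\<Sum>i<N. \<Sum>j<N. (cmod (prod_vec \<psi> \<phi> [i, j] - prod_vec \<psi> \<phi> [j, i]))\<^sup>2) = 2 - 2 * (cmod \<omega>)\<^sup>2"
    using sum_sq_antisym[of \<psi> \<phi> N] unit by (simp add: prod_vec_def unit_vec_def \<omega>_def)
  moreover have "(\<Sum>i<N. \<Sum>j<N. (cmod (prod_vec \<psi> \<phi> [i, j] - prod_vec \<psi> \<phi> [j, i]))\<^sup>2) \<le> energy (prod_vec \<psi> \<phi>)"
    unfolding energy_eq by (simp add: sum_nonneg)
  ultimately have om: "1 - (cmod \<omega>)\<^sup>2 < 1 / (2400000 * real N)" using less by (simp add: field_simps)
  have "(\<Sum>i<N. (cmod (\<delta> i))\<^sup>2) = 1 - (cmod \<omega>)\<^sup>2"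
    unfolding \<delta>_def using sum_sq_residual[OF _ \<omega>_def] unit by (simp add: unit_vec_def)
  then have "energy (prod_vec \<psi> \<delta>) \<le> 22 * (1 - (cmod \<omega>)\<^sup>2)"
    using energy_le[of "prod_vec \<psi> \<delta>"] unit by (simp add: norm_prod_vec unit_vec_def)
  \<comment> \<open>Replacing \<open>\<phi>\<close> by \<open>\<omega> * \<psi>\<close> changes the
    product vector by \<open>prod_vec \<psi> \<delta>\<close>, whose energy is controlled by its
    norm.\<close>
  moreover have "(\<lambda>x. \<omega> * prod_vec \<psi> \<psi> x) = (\<lambda>x. prod_vec \<psi> \<phi> x - prod_vec \<psi> \<delta> x)"
    by (intro ext) (simp add: prod_vec_def \<delta>_def algebra_simps)
  ultimately have "(cmod \<omega>)\<^sup>2 * energy (prod_vec \<psi> \<psi>) \<le>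
      2 * energy (prod_vec \<psi> \<phi>) + 2 * (22 * (1 - (cmod \<omega>)\<^sup>2))"
    using energy_diff_le[of "prod_vec \<psi> \<phi>" "prod_vec \<psi> \<delta>"] energy_scale[of \<omega> "prod_vec \<psi> \<psi>"] by simp
  \<comment> \<open>\<open>2/1200000 + 44/2400000 = 1/50000\<close>, half of the bound 1/25000 for
    squares; the other half is lost to \<open>(cmod \<omega>)^2 \<ge> 1/2\<close>.\<close>
  also have "\<dots> < 1 / (50000 * real N)" using less om N by (simp add: field_simps)
  finally have "(cmod \<omega>)\<^sup>2 * energy (prod_vec \<psi> \<psi>) < 1 / (50000 * real N)" .
  moreover have "(cmod \<omega>)\<^sup>2 \<ge> 1 / 2"
  proof -
    have "1 / (2400000 * real N) \<le> 1 / 2" using N by (simp add: field_simps)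
    then show ?thesis using om by linarith
  qed
  then have "1 / 2 * (1 / (25000 * real N)) \<le> (cmod \<omega>)\<^sup>2 * energy (prod_vec \<psi> \<psi>)"
    using energy_square_ge[OF unit(1)] by (intro mult_mono) auto
  ultimately show False by simp
qed

text \<open>\<open>26400000 = 22 * 1200000\<close>, the operator bound times the energy
  constant.\<close>

lemma instance_gap:
  "hermitian N 2 Mop" "psd N 2 Mop" "psd N 2 (\<lambda>x y. id_op x y - Mop x y)"
  "hSep N Mop \<le> 1 - 1 / (26400000 * real N)"
  "1 \<le> k \<Longrightarrow> 8 * k \<le> s \<Longrightarrow> DPS N k Mop = 1"
proof -
  show "hSep N Mop \<le> 1 - 1 / (26400000 * real N)"
    using hSep_le[OF _ energy_prod_ge] N_pos by simp
  show "1 \<le> k \<Longrightarrow> 8 * k \<le> s \<Longrightarrow> DPS N k Mop = 1"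
    using DPS_eq_1[OF kext_ppt_rho tr_prod_lap_rho] N_pos by blast
qed (rule hermitian_Mop psd_Mop[OF energy_le] psd_id_minus_Mop)+

end

section \<open>Existence of good XOR systems\<close>

text \<open>A crude Stirling bound: passing from \<open>t\<close> to \<open>t + 1\<close> costs the
  factor \<open>(1 + 1/t)^t \<le> e \<le> 3\<close>.\<close>

lemma power_self_le_fact: "real t ^ t \<le> 3 ^ t * fact t"
proof (induction t)
  case (Suc t)
  show ?case
  proof (cases "t = 0")
    case False
    have "(1 + 1 / real t) ^ t \<le> exp 1"
      by (rule exp_ge_one_plus_x_over_n_power_n) (use False in auto)
    also have "\<dots> \<le> (3 :: real)" by (rule exp_le)
    finally have "(1 + 1 / real t) ^ t * real t ^ t \<le> 3 * (3 ^ t * fact t)"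
      using Suc by (intro mult_mono) auto
    moreover have "(1 + 1 / real t) * real t = real (Suc t)" using False by (simp add: field_simps)
    ultimately have "real (Suc t) ^ t \<le> 3 * (3 ^ t * fact t)" by (simp flip: power_mult_distrib)
    from mult_left_mono[OF this, of "real (Suc t)"] show ?thesis by (simp add: mult_ac)
  qed simp
qed simp

text \<open>The usual bound \<open>(e * n / t)^t\<close> with \<open>e\<close> rounded up to 3,
  multiplied out so that \<open>t = 0\<close> is covered.\<close>

lemma choose_power_self_le: "real (n choose t) * real t ^ t \<le> (3 * real n) ^ t"
proof -
  have "real (n choose t) * real t ^ t \<le> real (n choose t) * (3 ^ t * fact t)"
    by (intro mult_left_mono power_self_le_fact) auto
  also have "\<dots> = 3 ^ t * real ((n choose t) * fact t)" by simp
  also have "\<dots> \<le> 3 ^ t * real (n ^ t)"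
    by (intro mult_left_mono of_nat_mono binomial_fact_pow) auto
  finally show ?thesis by (simp add: power_mult_distrib)
qed

text \<open>One term of the union bound for non-expansion. Of the \<open>4 * t\<close> factors
  \<open>j/N\<close>, \<open>j\<close> pay for the choice of variables; the others, at least
  \<open>3 * t / 2\<close>, beat the at most \<open>(48 * N / t)^t\<close> choices of
  constraints.\<close>

lemma expansion_term_le:
  assumes t: "t \<ge> 1" "10 ^ 9 * t \<le> N" and j: "2 * j \<le> 5 * t"
  shows "real (16 * N choose t) * real (N choose j) * (real j / real N) ^ (4 * t) \<le> (1 / 4) ^ t"
proof -
  have N: "real N > 0" and t0: "real t > 0" using t by auto
  \<comment> \<open>\<open>q^2 = 5 * t / (2 * N)\<close> bounds \<open>j/N\<close>. The product is
    then at most \<open>(3240 * q)^t\<close>, and \<open>12960 = 4 * 3240\<close> makes the base at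
    most 1/4.\<close>
  define q where "q = sqrt (5 * real t / (2 * real N))"
  have q2: "q\<^sup>2 = 5 * real t / (2 * real N)" unfolding q_def using N by simp
  have q0: "q > 0" unfolding q_def using N t0 by simp
  have "real (10 ^ 9 * t) \<le> real N" using t by (simp only: of_nat_le_iff)
  then have "q\<^sup>2 \<le> (1 / 12960)\<^sup>2" unfolding q2 using N by (simp add: field_simps power2_eq_square)
  then have q: "q \<le> 1 / 12960" by (rule power2_le_imp_le) simp
  have jN: "real j / real N \<le> q\<^sup>2" unfolding q2 using j N by (simp add: field_simps)
  have "(real j / real N) ^ (4 * t - j) \<le> (q\<^sup>2) ^ (4 * t - j)"
    using jN by (intro power_mono) auto
  also have "\<dots> = q ^ (2 * (4 * t - j))" by (simp add: power_mult)
  also have "\<dots> \<le> q ^ (3 * t)" using q q0 j by (intro power_decreasing) auto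
  finally have 1: "(real j / real N) ^ (4 * t - j) \<le> q ^ (3 * t)" .
  have 2: "real (N choose j) * (real j / real N) ^ j \<le> 27 ^ t"
  proof -
    have "real (N choose j) * (real j / real N) ^ j \<le> 3 ^ j"
      using choose_power_self_le[of N j] N by (simp add: power_divide power_mult_distrib field_simps)
    also have "\<dots> \<le> (3 :: real) ^ (3 * t)" using j by (intro power_increasing) auto
    finally show ?thesis by (simp add: power_mult)
  qed
  have 3: "real (16 * N choose t) \<le> (120 / q\<^sup>2) ^ t"
  proof -
    have "real (16 * N choose t) \<le> (3 * real (16 * N)) ^ t / real t ^ t"
      using choose_power_self_le[of "16 * N" t] t0 by (simp add: field_simps)
    also have "\<dots> = (120 / q\<^sup>2) ^ t" unfolding q2 power_divide[symmetric] using N t0 by (simp add: field_simps)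
    finally show ?thesis .
  qed
  have "(real j / real N) ^ (4 * t) = (real j / real N) ^ j * (real j / real N) ^ (4 * t - j)"
    using j by (simp flip: power_add)
  then have "real (16 * N choose t) * real (N choose j) * (real j / real N) ^ (4 * t) =
    real (16 * N choose t) * ((real (N choose j) * (real j / real N) ^ j) * (real j / real N) ^ (4 * t - j))"
    by (simp add: mult_ac)
  also have "\<dots> \<le> (120 / q\<^sup>2) ^ t * (27 ^ t * q ^ (3 * t))"
    using 1 2 3 by (intro mult_mono) auto
  also have "\<dots> = (120 / q\<^sup>2 * (27 * q ^ 3)) ^ t"
    unfolding power_mult_distrib power_mult by simp
  also have "120 / q\<^sup>2 * (27 * q ^ 3) = 3240 * q"
    using q0 by (simp add: power2_eq_square power3_eq_cube)
  also have "(3240 * q) ^ t \<le> (1 / 4) ^ t"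
    using q q0 by (intro power_mono) auto
  finally show ?thesis .
qed

section \<open>Counting random instances\<close>

definition labelled :: "nat \<Rightarrow> (nat list \<times> real) set" where
  "labelled N = idx N 4 \<times> {-1, 1}"

text \<open>Uniformly random systems, with probabilities expressed as cardinalities. Extensional
  functions give a finite set that factorises over the constraints.\<close>

definition instances :: "nat \<Rightarrow> nat \<Rightarrow> (nat \<Rightarrow> nat list \<times> real) set" where
  "instances N m = PiE {..<m} (\<lambda>_. labelled N)"

lemma finite_labelled [simp]: "finite (labelled N)"
  by (simp add: labelled_def)

lemma card_labelled: "card (labelled N) = 2 * N ^ 4"
  by (simp add: labelled_def card_cartesian_product card_idx)

lemma finite_instances [simp]: "finite (instances N m)"
  by (simp add: instances_def finite_PiE)

lemma card_instances: "card (instances N m) = (2 * N ^ 4) ^ m"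
  by (simp add: instances_def card_PiE card_labelled)

text \<open>The \<open>4 * card I\<close> positions are independent, and each lies in
  \<open>J\<close> with probability \<open>card J / N\<close>.\<close>

lemma card_instances_confined:
  assumes I: "I \<subseteq> {..<m}" and J: "J \<subseteq> {..<N}" and N: "N > 0"
  shows "real (card {\<omega> \<in> instances N m. \<forall>c\<in>I. set (fst (\<omega> c)) \<subseteq> J}) =
    real (card (instances N m)) * (real (card J) / real N) ^ (4 * card I)"
proof -
  have finI: "finite I" and finJ: "finite J" using I J finite_subset by blast+
  define B where "B = {l. set l \<subseteq> J \<and> length l = 4} \<times> {-1, 1 :: real}"
  have cardB: "card B = 2 * card J ^ 4"
    unfolding B_def using card_lists_length_eq[OF finJ, of 4] by (simp add: card_cartesian_product)
  have sub: "a \<in> labelled N \<and> set (fst a) \<subseteq> J \<longleftrightarrow> a \<in> B" for a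
    using J by (cases a) (auto simp: B_def labelled_def idx_def)
  have "{\<omega> \<in> instances N m. \<forall>c\<in>I. set (fst (\<omega> c)) \<subseteq> J} =
    PiE {..<m} (\<lambda>c. if c \<in> I then B else labelled N)" (is "?L = ?R")
  proof (intro subset_antisym subsetI)
    fix \<omega> assume "\<omega> \<in> ?L"
    then have "\<omega> c \<in> (if c \<in> I then B else labelled N)" if "c < m" for c
      using sub[of "\<omega> c"] that by (auto simp: instances_def PiE_iff simp del: split_paired_All)
    with \<open>\<omega> \<in> ?L\<close> show "\<omega> \<in> ?R" unfolding instances_def PiE_iff by simp
  next
    fix \<omega> assume R: "\<omega> \<in> ?R"
    have "\<omega> c \<in> labelled N" "c \<in> I \<Longrightarrow> set (fst (\<omega> c)) \<subseteq> J" if "c < m" for c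
      using PiE_mem[OF R, of c] that sub[of "\<omega> c"] by (auto split: if_splits)
    then show "\<omega> \<in> ?L" using R I by (auto simp: instances_def PiE_iff)
  qed
  then have "card {\<omega> \<in> instances N m. \<forall>c\<in>I. set (fst (\<omega> c)) \<subseteq> J} =
      (\<Prod>c<m. if c \<in> I then card B else card (labelled N))"
    by (simp add: card_PiE if_distrib cong: if_cong)
  also have "\<dots> = card B ^ card I * card (labelled N) ^ (m - card I)"
  proof -
    have "{..<m} \<inter> I = I" "{..<m} \<inter> - I = {..<m} - I" using I by auto
    then show ?thesis using I finI by (simp add: prod.If_cases card_Diff_subset)
  qed
  finally have "card {\<omega> \<in> instances N m. \<forall>c\<in>I. set (fst (\<omega> c)) \<subseteq> J} =
    (2 * card J ^ 4) ^ card I * (2 * N ^ 4) ^ (m - card I)" unfolding cardB card_labelled .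
  moreover have "card I \<le> m" using card_mono[OF _ I] by simp
  then have "(2 * real N ^ 4) ^ m = (2 * real N ^ 4) ^ card I * (2 * real N ^ 4) ^ (m - card I)"
    unfolding power_add[symmetric] by simp
  ultimately show ?thesis using N
    by (simp add: card_instances power_mult power_divide power_mult_distrib)
qed

definition non_expanding :: "nat \<Rightarrow> nat \<Rightarrow> nat \<Rightarrow> (nat \<Rightarrow> nat list \<times> real) set" where
  "non_expanding N m s = {\<omega> \<in> instances N m. \<exists>I\<subseteq>{..<m}. card I \<le> s \<and>
     2 * card (\<Union>c\<in>I. set (fst (\<omega> c))) < 5 * card I}"

text \<open>Union bound over a non-expanding set of \<open>t\<close> constraints and a set
  \<open>J\<close> containing its variables; the terms are at most \<open>(1/4)^t\<close> and sum to
  at most 1/3.\<close>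

lemma card_non_expanding:
  assumes s: "10 ^ 9 * s \<le> N" and N: "N > 0"
  shows "real (card (non_expanding N (16 * N) s)) \<le> real (card (instances N (16 * N))) / 3"
proof -
  define m where "m = 16 * N"
  \<comment> \<open>For \<open>t \<ge> 1\<close> this is the largest integer strictly below
    \<open>5 * t / 2\<close>.\<close>
  define jj where "jj t = (5 * t - 1) div 2" for t :: nat
  define Sub where "Sub A t = {I. I \<subseteq> A \<and> card I = t}" for A :: "nat set" and t
  define conf where "conf I J = {\<omega> \<in> instances N m. \<forall>c\<in>I. set (fst (\<omega> c)) \<subseteq> J}" for I J
  define \<Omega> where "\<Omega> = real (card (instances N m))"
  have finSub: "finite (Sub A t)" if "finite A" for A t
    unfolding Sub_def using that by simp
  have cardSub: "card (Sub {..<n} t) = n choose t" for n t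
    unfolding Sub_def using n_subsets[of "{..<n}" t] by simp
  have "non_expanding N m s \<subseteq> (\<Union>t\<in>{1..s}. \<Union>(I, J)\<in>Sub {..<m} t \<times> Sub {..<N} (jj t). conf I J)"
  proof
    fix \<omega> assume "\<omega> \<in> non_expanding N m s"
    then obtain I where \<omega>: "\<omega> \<in> instances N m" and I: "I \<subseteq> {..<m}" "card I \<le> s"
      and lt: "2 * card (\<Union>c\<in>I. set (fst (\<omega> c))) < 5 * card I"
      unfolding non_expanding_def by blast
    define G where "G = (\<Union>c\<in>I. set (fst (\<omega> c)))"
    have "G \<subseteq> {..<N}"
    proof -
      have "set (fst (\<omega> c)) \<subseteq> {..<N}" if "c \<in> I" for c
      proof -
        have "\<omega> c \<in> labelled N" using \<omega> I that unfolding instances_def by auto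
        then show ?thesis by (auto simp: labelled_def idx_def)
      qed
      then show ?thesis unfolding G_def by blast
    qed
    moreover have "card G \<le> jj (card I)" "jj (card I) \<le> N"
      using lt I s unfolding G_def[symmetric] jj_def by auto
    ultimately obtain J where "G \<subseteq> J" "J \<subseteq> {..<N}" "card J = jj (card I)"
      using exists_subset_between[of G "jj (card I)" "{..<N}"] by auto
    then have "\<omega> \<in> conf I J" "(I, J) \<in> Sub {..<m} (card I) \<times> Sub {..<N} (jj (card I))"
      using \<omega> I unfolding conf_def Sub_def G_def by auto
    moreover have "card I \<in> {1..s}" using lt I by auto
    ultimately show "\<omega> \<in> (\<Union>t\<in>{1..s}. \<Union>(I, J)\<in>Sub {..<m} t \<times> Sub {..<N} (jj t). conf I J)" by blast
  qed
  then have "card (non_expanding N m s) \<le>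
      card (\<Union>t\<in>{1..s}. \<Union>(I, J)\<in>Sub {..<m} t \<times> Sub {..<N} (jj t). conf I J)"
    by (intro card_mono) (auto simp: finSub conf_def)
  also have "\<dots> \<le> (\<Sum>t\<in>{1..s}. card (\<Union>(I, J)\<in>Sub {..<m} t \<times> Sub {..<N} (jj t). conf I J))"
    by (rule card_UN_le) simp
  also have "\<dots> \<le> (\<Sum>t\<in>{1..s}. \<Sum>(I, J)\<in>Sub {..<m} t \<times> Sub {..<N} (jj t). card (conf I J))"
  proof (rule sum_mono)
    fix t
    show "card (\<Union>(I, J)\<in>Sub {..<m} t \<times> Sub {..<N} (jj t). conf I J) \<le>
      (\<Sum>(I, J)\<in>Sub {..<m} t \<times> Sub {..<N} (jj t). card (conf I J))"
      using card_UN_le[of "Sub {..<m} t \<times> Sub {..<N} (jj t)" "\<lambda>(I, J). conf I J"] finSub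
      by (simp add: split_def)
  qed
  finally have "real (card (non_expanding N m s)) \<le>
      real (\<Sum>t\<in>{1..s}. \<Sum>(I, J)\<in>Sub {..<m} t \<times> Sub {..<N} (jj t). card (conf I J))"
    by (rule of_nat_mono)
  also have "\<dots> = (\<Sum>t\<in>{1..s}. \<Sum>(I, J)\<in>Sub {..<m} t \<times> Sub {..<N} (jj t). real (card (conf I J)))"
    by (simp add: split_def)
  also have "\<dots> = (\<Sum>t\<in>{1..s}. \<Sum>(I, J)\<in>Sub {..<m} t \<times> Sub {..<N} (jj t). \<Omega> * (real (jj t) / real N) ^ (4 * t))"
  proof (intro sum.cong refl, clarify)
    fix t I J assume "I \<in> Sub {..<m} t" "J \<in> Sub {..<N} (jj t)"
    then show "real (card (conf I J)) = \<Omega> * (real (jj t) / real N) ^ (4 * t)"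
      using card_instances_confined[of I m J N] N unfolding Sub_def conf_def \<Omega>_def by auto
  qed
  also have "\<dots> = \<Omega> * (\<Sum>t\<in>{1..s}. real (m choose t) * real (N choose jj t) * (real (jj t) / real N) ^ (4 * t))"
    unfolding sum_distrib_left by (simp add: card_cartesian_product cardSub mult_ac)
  also have "\<dots> \<le> \<Omega> * (\<Sum>t\<in>{1..s}. (1 / 4) ^ t)"
  proof (intro mult_left_mono sum_mono)
    fix t assume "t \<in> {1..s}"
    then show "real (m choose t) * real (N choose jj t) * (real (jj t) / real N) ^ (4 * t) \<le> (1 / 4) ^ t"
      unfolding m_def using s by (intro expansion_term_le) (auto simp: jj_def)
  qed (simp add: \<Omega>_def)
  also have "(\<Sum>t\<in>{1..s}. (1 / 4 :: real) ^ t) \<le> 1 / 3"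
  proof -
    have "(\<Sum>t\<in>{1..s}. (1 / 4 :: real) ^ t) = 1 / 3 - (1 / 4) ^ s / 3"
      by (induction s) auto
    then show ?thesis by simp
  qed
  finally show ?thesis unfolding m_def \<Omega>_def by (simp add: mult_left_mono)
qed

text \<open>At least a fraction \<open>(19/20)^4 \<ge> 4/5\<close> of the tuples avoids discarded
  variables, and each of these has a violating label.\<close>

lemma card_violated_labels_ge:
  fixes x :: "nat \<Rightarrow> real"
  assumes x: "\<And>i. i < N \<Longrightarrow> x i \<in> {-1, 0, 1}" and z: "20 * card {i. i < N \<and> x i = 0} \<le> N"
  shows "4 / 5 * real N ^ 4 \<le> real (card {a \<in> labelled N. snd a * prod_list (map x (fst a)) = -1})"
proof -
  define Z where "Z = {i. i < N \<and> x i \<noteq> 0}"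
  have "{..<N} = Z \<union> {i. i < N \<and> x i = 0}" unfolding Z_def by auto
  then have "card {..<N} \<le> card Z + card {i. i < N \<and> x i = 0}" by (metis card_Un_le)
  then have "N \<le> card Z + card {i. i < N \<and> x i = 0}" by simp
  then have "real N \<le> real (card Z) + real (card {i. i < N \<and> x i = 0})"
    "20 * real (card {i. i < N \<and> x i = 0}) \<le> real N" using z by linarith+
  then have Z: "19 / 20 * real N \<le> real (card Z)" by linarith
  have finZ: "finite Z" unfolding Z_def by simp
  have sq: "prod_list (map x l) * prod_list (map x l) = 1" if "set l \<subseteq> Z" for l
    using that
  proof (induction l)
    case (Cons a l)
    then have "x a * x a = 1" using x[of a] by (auto simp: Z_def)
    then show ?case using Cons by (simp add: mult_ac mult.left_commute[of "x a" "x a"])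
  qed simp
  define g where "g l = (l, - prod_list (map x l))" for l
  have "real (card Z ^ 4) = real (card {l. set l \<subseteq> Z \<and> length l = 4})"
    using card_lists_length_eq[OF finZ, of 4] by simp
  also have "\<dots> = real (card (g ` {l. set l \<subseteq> Z \<and> length l = 4}))"
    by (subst card_image) (auto simp: inj_on_def g_def)
  also have "\<dots> \<le> real (card {a \<in> labelled N. snd a * prod_list (map x (fst a)) = -1})"
  proof (intro of_nat_mono card_mono)
    show "g ` {l. set l \<subseteq> Z \<and> length l = 4} \<subseteq> {a \<in> labelled N. snd a * prod_list (map x (fst a)) = -1}"
    proof (intro image_subsetI)
      fix l assume l: "l \<in> {l. set l \<subseteq> Z \<and> length l = 4}"
      then have "(prod_list (map x l))\<^sup>2 = 1" using sq by (simp add: power2_eq_square)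
      then have "prod_list (map x l) = 1 \<or> prod_list (map x l) = -1" by (simp add: power2_eq_1_iff)
      then show "g l \<in> {a \<in> labelled N. snd a * prod_list (map x (fst a)) = -1}"
        using l by (auto simp: g_def labelled_def idx_def Z_def)
    qed
  qed simp
  finally have "real (card Z ^ 4) \<le> real (card {a \<in> labelled N. snd a * prod_list (map x (fst a)) = -1})" .
  moreover have "(19 / 20 * real N) ^ 4 \<le> real (card Z) ^ 4" using Z by (intro power_mono) auto
  moreover have "(4 / 5 :: real) \<le> (19 / 20) ^ 4" by (simp add: power_divide)
  then have "4 / 5 * real N ^ 4 \<le> (19 / 20 * real N) ^ 4"
    unfolding power_mult_distrib by (intro mult_right_mono) auto
  ultimately show ?thesis unfolding of_nat_power by linarith
qed

text \<open>Markov's inequality for \<open>(1/2) ^ viol\<close>, whose expectation factorises.\<close>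
lemma card_few_violated:
  fixes x :: "nat \<Rightarrow> real"
  assumes x: "\<And>i. i < N \<Longrightarrow> x i \<in> {-1, 0, 1}" and z: "20 * card {i. i < N \<and> x i = 0} \<le> N"
  shows "real (card {\<omega> \<in> instances N m.
      card {c. c < m \<and> snd (\<omega> c) * prod_list (map x (fst (\<omega> c))) = -1} < n}) \<le>
    2 ^ n * (4 / 5) ^ m * real (card (instances N m))"
proof -
  define viol where "viol a \<longleftrightarrow> snd a * prod_list (map x (fst a)) = -1" for a
  define h :: "nat list \<times> real \<Rightarrow> real" where "h a = (if viol a then 1 / 2 else 1)" for a
  define V where "V \<omega> = card {c. c < m \<and> viol (\<omega> c)}" for \<omega>
  define Bad where "Bad = {\<omega> \<in> instances N m. V \<omega> < n}"
  have prod_h: "(\<Prod>c<m. h (\<omega> c)) = (1 / 2) ^ V \<omega>" for \<omega>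
  proof -
    have "{..<m} \<inter> {c. viol (\<omega> c)} = {c. c < m \<and> viol (\<omega> c)}" by auto
    then show ?thesis unfolding h_def V_def by (simp add: prod.If_cases)
  qed
  \<comment> \<open>At least two fifths of the labelled tuples are violated, so \<open>h\<close> has
    average at most \<open>1 - (2/5)/2 = 4/5\<close>.\<close>
  have "(\<Sum>a\<in>labelled N. h a) = (\<Sum>a\<in>labelled N. 1 - (if viol a then 1 / 2 else 0))"
    by (intro sum.cong) (auto simp: h_def)
  also have "\<dots> = real (card (labelled N)) - real (card {a \<in> labelled N. viol a}) / 2"
    by (simp add: sum_subtractf sum.If_cases Int_def)
  also have "\<dots> \<le> 4 / 5 * (2 * real N ^ 4)"
    using card_violated_labels_ge[OF x z] unfolding viol_def card_labelled by simp
  finally have h: "(\<Sum>a\<in>labelled N. h a) \<le> 4 / 5 * (2 * real N ^ 4)" .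
  have "real (card Bad) * (1 / 2) ^ n = (\<Sum>\<omega>\<in>Bad. (1 / 2) ^ n)" by simp
  also have "\<dots> \<le> (\<Sum>\<omega>\<in>Bad. (1 / 2) ^ V \<omega>)"
    by (intro sum_mono power_decreasing) (auto simp: Bad_def)
  also have "\<dots> \<le> (\<Sum>\<omega>\<in>instances N m. (1 / 2) ^ V \<omega>)"
    by (intro sum_mono2) (auto simp: Bad_def)
  also have "\<dots> = (\<Sum>\<omega>\<in>instances N m. \<Prod>c<m. h (\<omega> c))" unfolding prod_h ..
  also have "\<dots> = (\<Prod>c<m. \<Sum>a\<in>labelled N. h a)"
    unfolding instances_def by (rule prod_sum_PiE[symmetric]) auto
  also have "\<dots> = (\<Sum>a\<in>labelled N. h a) ^ m" by simp
  also have "\<dots> \<le> (4 / 5 * (2 * real N ^ 4)) ^ m"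
    using h by (intro power_mono sum_nonneg) (auto simp: h_def)
  also have "\<dots> = (4 / 5) ^ m * real (card (instances N m))"
    unfolding power_mult_distrib[of "4 / 5"] card_instances by simp
  finally show ?thesis unfolding Bad_def V_def viol_def
    by (simp add: power_divide field_simps)
qed

definition weakly_violated :: "nat \<Rightarrow> nat \<Rightarrow> (nat \<Rightarrow> nat list \<times> real) set" where
  "weakly_violated N m = {\<omega> \<in> instances N m. \<exists>x :: nat \<Rightarrow> real.
     (\<forall>i<N. x i \<in> {-1, 0, 1}) \<and> 20 * card {i. i < N \<and> x i = 0} \<le> N \<and>
     card {c. c < m \<and> snd (\<omega> c) * prod_list (map x (fst (\<omega> c))) = -1} < N}"

text \<open>Union bound over at most \<open>3^N\<close> assignments, each failing with probability
  at most \<open>2^N * (4/5)^(16 * N)\<close>. Taking \<open>16 * N\<close> constraints makes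
  \<open>6 * (4/5)^16 \<le> 1/2\<close>.\<close>

lemma card_weakly_violated:
  assumes N: "N > 0"
  shows "real (card (weakly_violated N (16 * N))) \<le> real (card (instances N (16 * N))) / 2"
proof -
  define m where "m = 16 * N"
  define \<Omega> where "\<Omega> = real (card (instances N m))"
  define X :: "(nat \<Rightarrow> real) set" where
    "X = {x \<in> PiE {..<N} (\<lambda>_. {-1, 0, 1}). 20 * card {i. i < N \<and> x i = 0} \<le> N}"
  define Bad where "Bad x = {\<omega> \<in> instances N m.
      card {c. c < m \<and> snd (\<omega> c) * prod_list (map x (fst (\<omega> c))) = -1} < N}" for x :: "nat \<Rightarrow> real"
  have finX: "finite X" unfolding X_def by (simp add: finite_PiE)
  have "card X \<le> card (PiE {..<N} (\<lambda>_. {-1, 0, 1 :: real}))"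
    unfolding X_def by (intro card_mono finite_PiE) auto
  also have "\<dots> = 3 ^ N" by (simp add: card_PiE numeral_3_eq_3)
  finally have cardX: "real (card X) \<le> 3 ^ N"
    using of_nat_mono[of "card X" "3 ^ N", where 'a = real] by simp
  have "weakly_violated N m \<subseteq> (\<Union>x\<in>X. Bad x)"
  proof
    fix \<omega> assume "\<omega> \<in> weakly_violated N m"
    then obtain x :: "nat \<Rightarrow> real" where \<omega>: "\<omega> \<in> instances N m" and x: "\<forall>i<N. x i \<in> {-1, 0, 1}"
      and z: "20 * card {i. i < N \<and> x i = 0} \<le> N"
      and lt: "card {c. c < m \<and> snd (\<omega> c) * prod_list (map x (fst (\<omega> c))) = -1} < N"
      unfolding weakly_violated_def by blast
    \<comment> \<open>Only values below \<open>N\<close> matter; restricting makes the assignments a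
      finite family.\<close>
    define y where "y = restrict x {..<N}"
    have "{i. i < N \<and> y i = 0} = {i. i < N \<and> x i = 0}" unfolding y_def by auto
    then have "y \<in> X" unfolding X_def using x z by (auto simp: y_def)
    moreover have "map y (fst (\<omega> c)) = map x (fst (\<omega> c))" if "c < m" for c
    proof -
      have "\<omega> c \<in> labelled N" using \<omega> that unfolding instances_def by auto
      then show ?thesis unfolding y_def labelled_def idx_def by (cases "\<omega> c") auto
    qed
    then have prod_eq: "prod_list (map y (fst (\<omega> c))) = prod_list (map x (fst (\<omega> c)))" if "c < m" for c
      using that by presburger
    have "{c. c < m \<and> snd (\<omega> c) * prod_list (map y (fst (\<omega> c))) = -1} =
      {c. c < m \<and> snd (\<omega> c) * prod_list (map x (fst (\<omega> c))) = -1}"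
      using prod_eq by (auto simp del: map_eq_conv)
    then have "\<omega> \<in> Bad y" unfolding Bad_def using \<omega> lt by simp
    ultimately show "\<omega> \<in> (\<Union>x\<in>X. Bad x)" by blast
  qed
  then have "card (weakly_violated N m) \<le> card (\<Union>x\<in>X. Bad x)"
    by (intro card_mono) (auto simp: finX Bad_def)
  also have "\<dots> \<le> (\<Sum>x\<in>X. card (Bad x))" by (rule card_UN_le[OF finX])
  finally have "real (card (weakly_violated N m)) \<le> real (\<Sum>x\<in>X. card (Bad x))" by (rule of_nat_mono)
  also have "\<dots> = (\<Sum>x\<in>X. real (card (Bad x)))" by simp
  also have "\<dots> \<le> (\<Sum>x\<in>X. 2 ^ N * (4 / 5) ^ m * \<Omega>)"
  proof (rule sum_mono)
    fix x assume "x \<in> X"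
    then show "real (card (Bad x)) \<le> 2 ^ N * (4 / 5) ^ m * \<Omega>"
      unfolding Bad_def \<Omega>_def X_def by (intro card_few_violated) auto
  qed
  also have "\<dots> = real (card X) * (2 ^ N * (4 / 5) ^ m * \<Omega>)" by simp
  also have "\<dots> \<le> 3 ^ N * (2 ^ N * (4 / 5) ^ m * \<Omega>)"
    using cardX by (intro mult_right_mono) (auto simp: \<Omega>_def)
  also have "\<dots> = (3 * 2 * (4 / 5) ^ 16) ^ N * \<Omega>"
    unfolding m_def power_mult_distrib power_mult by simp
  also have "\<dots> \<le> (1 / 2) ^ N * \<Omega>"
    by (intro mult_right_mono power_mono) (auto simp: \<Omega>_def power_divide)
  also have "\<dots> \<le> 1 / 2 * \<Omega>"
    using power_decreasing[of 1 N "1 / 2 :: real"] N by (intro mult_right_mono) (auto simp: \<Omega>_def)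
  finally show ?thesis unfolding \<Omega>_def m_def by simp
qed

lemma exists_good_instance:
  assumes s: "10 ^ 9 * s \<le> N" and N: "N > 0"
  obtains \<omega> where "\<omega> \<in> instances N (16 * N)" "\<omega> \<notin> non_expanding N (16 * N) s"
    "\<omega> \<notin> weakly_violated N (16 * N)"
proof -
  define \<Omega> where "\<Omega> = instances N (16 * N)"
  have pos: "card \<Omega> > 0" unfolding \<Omega>_def card_instances using N by simp
  have "real (card (non_expanding N (16 * N) s \<union> weakly_violated N (16 * N))) \<le>
    real (card (non_expanding N (16 * N) s)) + real (card (weakly_violated N (16 * N)))"
    using of_nat_mono[OF card_Un_le, where 'a = real] by simp
  also have "\<dots> \<le> real (card \<Omega>) / 3 + real (card \<Omega>) / 2"
    using card_non_expanding[OF s N] card_weakly_violated[OF N] unfolding \<Omega>_def by linarith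
  also have "\<dots> < real (card \<Omega>)" using pos by simp
  finally have "non_expanding N (16 * N) s \<union> weakly_violated N (16 * N) \<noteq> \<Omega>" by auto
  moreover have "non_expanding N (16 * N) s \<union> weakly_violated N (16 * N) \<subseteq> \<Omega>"
    unfolding non_expanding_def weakly_violated_def \<Omega>_def by auto
  ultimately show ?thesis using that unfolding \<Omega>_def by blast
qed

section \<open>The gap\<close>

lemma exists_gap_operator:
  assumes n: "n \<ge> 5 * 10 ^ 9"
  shows "\<exists>M. hermitian n 2 M \<and> psd n 2 M \<and> psd n 2 (\<lambda>x y. id_op x y - M x y) \<and>
    hSep n M \<le> 1 - 1 / (26400000 * real n) \<and>
    (\<forall>k. 1 \<le> k \<and> 8 * k \<le> n div 10 ^ 9 \<longrightarrow> DPS n k M = 1)"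
proof -
  define s where "s = n div 10 ^ 9"
  have s: "10 ^ 9 * s \<le> n" "s \<ge> 5" and n0: "n > 0"
    unfolding s_def using n div_le_mono[OF n, of "10 ^ 9"] by simp_all
  obtain \<omega> where \<omega>: "\<omega> \<in> instances n (16 * n)" "\<omega> \<notin> non_expanding n (16 * n) s"
      "\<omega> \<notin> weakly_violated n (16 * n)"
    using exists_good_instance[OF s(1) n0] .
  have lab: "\<omega> c \<in> idx n 4 \<times> {-1, 1}" if "c < 16 * n" for c
    using \<omega>(1) that unfolding instances_def labelled_def by blast
  interpret xor_instance n "16 * n" s "\<lambda>c. fst (\<omega> c)" "\<lambda>c. snd (\<omega> c)"
  proof
    show "fst (\<omega> c) \<in> idx n 4" "snd (\<omega> c) * snd (\<omega> c) = 1" if "c < 16 * n" for c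
      using lab[OF that] by auto
    show "5 * card I \<le> 2 * card (\<Union>c\<in>I. set (fst (\<omega> c)))" if "I \<subseteq> {..<16 * n}" "card I \<le> s" for I
    proof (rule ccontr)
      assume "\<not> ?thesis"
      then have "\<exists>I\<subseteq>{..<16 * n}. card I \<le> s \<and> 2 * card (\<Union>c\<in>I. set (fst (\<omega> c))) < 5 * card I"
        using that by (intro exI[of _ I] conjI) simp_all
      then show False using \<omega>(1,2) unfolding non_expanding_def by blast
    qed
    show "n \<le> card {c. c < 16 * n \<and> snd (\<omega> c) * prod_list (map x (fst (\<omega> c))) = -1}"
      if "\<And>i. i < n \<Longrightarrow> x i \<in> {-1, 0, 1}" "20 * card {i. i < n \<and> x i = 0} \<le> n" for x
    proof (rule ccontr)
      assume "\<not> ?thesis"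
      then have "\<exists>x :: nat \<Rightarrow> real. (\<forall>i<n. x i \<in> {-1, 0, 1}) \<and> 20 * card {i. i < n \<and> x i = 0} \<le> n \<and>
          card {c. c < 16 * n \<and> snd (\<omega> c) * prod_list (map x (fst (\<omega> c))) = -1} < n"
        using that by (intro exI[of _ x]) (simp only: not_le, blast)
      then show False using \<omega>(1,3) unfolding weakly_violated_def by blast
    qed
  qed (use s n0 in auto)
  show ?thesis
    unfolding s_def[symmetric] using instance_gap by (intro exI[of _ Mop]) simp
qed

lemma psd_id: "psd d n id_op"
proof (rule psd_if_sum_of_squares)
  fix x y assume "x \<in> idx d n" "y \<in> idx d n"
  have "(\<Sum>t\<in>idx d n. of_bool (x = t) * cnj (of_bool (y = t))) =
    (\<Sum>t\<in>idx d n. if x = t then of_bool (y = t) else 0)"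
    by (intro sum.cong) auto
  then show "id_op x y = (\<Sum>t\<in>idx d n. of_bool (x = t) * cnj (of_bool (y = t)))"
    using \<open>x \<in> idx d n\<close> by (auto simp: id_op_def)
qed simp

theorem theorem4p10:
  shows "\<exists>(d :: nat \<Rightarrow> nat) (M :: nat \<Rightarrow> op).
    (\<forall>n. d n \<ge> 1 \<and> hermitian (d n) 2 (M n) \<and> psd (d n) 2 (M n) \<and>
         psd (d n) 2 (\<lambda>x y. id_op x y - M n x y)) \<and>
    (\<lambda>n. real (d n)) \<in> O(\<lambda>n. real n) \<and>
    (\<exists>c > 0. \<exists>a \<ge> 0. \<forall>\<^sub>F n in at_top.
        hSep (d n) (M n) \<le> 1 - c / (real n * ln (real n) powr a)) \<and>
    (\<forall>K :: nat \<Rightarrow> nat. (\<lambda>n. real (K n)) \<in> o(\<lambda>n. real n) \<longrightarrow>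
        (\<forall>\<^sub>F n in at_top. \<forall>k. 1 \<le> k \<and> k \<le> K n \<longrightarrow> DPS (d n) k (M n) = 1))"
proof -
  define n0 :: nat where "n0 = 5 * 10 ^ 9"
  have "\<forall>n. \<exists>M. n \<ge> n0 \<longrightarrow> (hermitian n 2 M \<and> psd n 2 M \<and> psd n 2 (\<lambda>x y. id_op x y - M x y) \<and>
      hSep n M \<le> 1 - 1 / (26400000 * real n) \<and>
      (\<forall>k. 1 \<le> k \<and> 8 * k \<le> n div 10 ^ 9 \<longrightarrow> DPS n k M = 1))"
    using exists_gap_operator unfolding n0_def by blast
  from choice[OF this] obtain M' where
    gap: "\<forall>n. n \<ge> n0 \<longrightarrow> (hermitian n 2 (M' n) \<and> psd n 2 (M' n) \<and>
      psd n 2 (\<lambda>x y. id_op x y - M' n x y) \<and> hSep n (M' n) \<le> 1 - 1 / (26400000 * real n) \<and>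
      (\<forall>k. 1 \<le> k \<and> 8 * k \<le> n div 10 ^ 9 \<longrightarrow> DPS n k (M' n) = 1))" ..
  \<comment> \<open>Below \<open>n0\<close>, dimension 1 and the identity meet the conditions
    demanded of every \<open>n\<close>; the other claims are asymptotic.\<close>
  define d where "d n = (if n \<ge> n0 then n else 1)" for n
  define M where "M n = (if n \<ge> n0 then M' n else id_op)" for n
  have large: "d n = n" "M n = M' n" if "n \<ge> n0" for n
    using that by (simp_all add: d_def M_def)
  have base: "d n \<ge> 1 \<and> hermitian (d n) 2 (M n) \<and> psd (d n) 2 (M n) \<and>
      psd (d n) 2 (\<lambda>x y. id_op x y - M n x y)" for n
  proof (cases "n \<ge> n0")
    case True
    moreover from this have "1 \<le> n" by (simp add: n0_def)
    ultimately show ?thesis using gap unfolding large[OF True] by blast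
  next
    case False
    have "psd 1 2 (\<lambda>x y. 0)" by (rule psd_if_sum_of_squares[where T = "{}"]) auto
    then show ?thesis using False psd_id[of 1 2] by (simp add: d_def M_def psd_def)
  qed
  have O: "(\<lambda>n. real (d n)) \<in> O(\<lambda>n. real n)"
    by (rule bigoI[where c = 1])
      (use large(1) in \<open>auto intro!: eventually_mono[OF eventually_ge_at_top[of n0]]\<close>)
  \<comment> \<open>The exponent is 0: the gap holds without logarithmic loss.\<close>
  have sep: "\<forall>\<^sub>F n in at_top. hSep (d n) (M n) \<le> 1 - (1 / 26400000) / (real n * ln (real n) powr 0)"
    using eventually_ge_at_top[of n0]
  proof eventually_elim
    case (elim n)
    \<comment> \<open>As \<open>0 powr 0 = 0\<close>, the factor \<open>ln (real n) powr 0\<close>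
      is 1 only for a nonzero logarithm.\<close>
    then have "ln (real n) \<noteq> 0" using ln_gt_zero[of "real n"] by (simp add: n0_def)
    then show ?case using gap elim unfolding large[OF elim] by simp
  qed
  have dps: "\<forall>\<^sub>F n in at_top. \<forall>k. 1 \<le> k \<and> k \<le> K n \<longrightarrow> DPS (d n) k (M n) = 1"
    if K: "(\<lambda>n. real (K n)) \<in> o(\<lambda>n. real n)" for K :: "nat \<Rightarrow> nat"
  proof -
    \<comment> \<open>This constant gives \<open>8 * K n \<le> n div 10 ^ 9\<close>, the range in
      which the DPS value is known.\<close>
    have "\<forall>\<^sub>F n in at_top. norm (real (K n)) \<le> 1 / (16 * 10 ^ 9) * norm (real n)"
      using landau_o.smallD[OF K, of "1 / (16 * 10 ^ 9)"] by simp
    then show ?thesis using eventually_ge_at_top[of n0]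
    proof eventually_elim
      case (elim n)
      show ?case
      proof (intro allI impI)
        fix k assume k: "1 \<le> k \<and> k \<le> K n"
        have "16 * 10 ^ 9 * real (K n) \<le> real n" using elim by (simp add: field_simps)
        then have "real (16 * 10 ^ 9 * K n) \<le> real n" by simp
        then have "16 * 10 ^ 9 * K n \<le> n" by (simp only: of_nat_le_iff)
        then have "8 * K n * 10 ^ 9 \<le> n" by simp
        then have "8 * K n \<le> n div 10 ^ 9" by (simp add: less_eq_div_iff_mult_less_eq)
        then have "8 * k \<le> n div 10 ^ 9" using k by linarith
        then show "DPS (d n) k (M n) = 1"
          using gap k elim(2) unfolding large[OF elim(2)] by blast
      qed
    qed
  qed
  have "\<exists>c > 0. \<exists>a \<ge> 0. \<forall>\<^sub>F n in at_top.
      hSep (d n) (M n) \<le> 1 - c / (real n * ln (real n) powr a)"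
    by (intro exI[of _ "1 / 26400000 :: real"] exI[of _ "0 :: real"] conjI sep) simp_all
  with base O dps show ?thesis by blast
qed

end
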